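(* For every special $\Pi^0_1$ set $P\subseteq2^{\mathbb N}$ there exists a $\Pi^0_1$ set $Q\subseteq2^{\mathbb N}$ with $Q<^1_\omega P$ and $P\equiv^{<\omega}_\omega Q$.
   Context: A set is special if it is nonempty and contains no computable element. Let $\{\Phi_e\}_{e\in\mathbb N}$ be an effective enumeration of all partial computable functions $\Phi_e:\subseteq\mathbb N^{\mathbb N}\to\mathbb N^{\mathbb N}$. A learner is a total computable function $\Psi:\mathbb N^{<\mathbb N}\to\mathbb N$; let $\{\Psi_e\}_{e\in\mathbb N}$ be an effective enumeration of all learners. A partial function $\Gamma:\subseteq\mathbb N^{\mathbb N}\to\mathbb N^{\mathbb N}$ is identified by $\Psi$ on $g$ if $\lim_n\Psi(g\upharpoonright n)$ exists and $\Phi_{\lim_n\Psi(g\upharpoonright n)}(g)=\Gamma(g)$. $\Gamma$ is $(1,\omega)$-computable if a single learner identifies it on every $g\in\mathrm{dom}(\Gamma)$. $\Gamma$ is $(<\omega,\omega)$-computable if there is $b\in\mathbb N$ such that for every $g\in\mathrm{dom}(\Gamma)$, $\Gamma$ is identified by $\Psi_e$ on $g$ for some $e<b$. For $A,B\subseteq\mathbb N^{\mathbb N}$, $A\le^\alpha_\beta B$ means there is an $(\alpha,\beta)$-computable $\Gamma$ with $B\subseteq\mathrm{dom}(\Gamma)$ and $\Gamma(g)\in A$ for every $g\in B$. $A<^\alpha_\beta B$ means $A\le^\alpha_\beta B$ and $B\not\le^\alpha_\beta A$; $A\equiv^\alpha_\beta B$ means both reductions hold. *)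

theory Defs
  imports Complex_Main "HOL-Library.Nat_Bijection"
begin

text \<open>
  Programs for the partial functions \<open>\<nat> \<rightharpoonup> \<nat>\<close> that are recursive relative to an oracle
  \<open>g : \<nat> \<rightarrow> \<nat>\<close>. All programs are unary; several arguments are passed through the pairing
  function \<^const>\<open>prod_encode\<close>. The identity is \<open>Pair Fst Snd\<close>.
\<close>

datatype code =
    Zero | Succ | Fst | Snd | Oracle
  | Pair code code | Comp code code | Prec code code | Mu code

primrec run :: "code \<Rightarrow> (nat \<Rightarrow> nat) \<Rightarrow> nat \<Rightarrow> nat option" where
  "run Zero g x = Some 0"
| "run Succ g x = Some (Suc x)"
| "run Fst g x = Some (fst (prod_decode x))"
| "run Snd g x = Some (snd (prod_decode x))"
| "run Oracle g x = Some (g x)"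
| "run (Pair c d) g x =
     Option.bind (run c g x) (\<lambda>u. Option.bind (run d g x) (\<lambda>v. Some (prod_encode (u, v))))"
| "run (Comp c d) g x = Option.bind (run d g x) (run c g)"
| "run (Prec c d) g x =
     (let (a, n) = prod_decode x in
      rec_nat (run c g a)
        (\<lambda>k r. Option.bind r (\<lambda>v. run d g (prod_encode (a, prod_encode (k, v))))) n)"
| "run (Mu c) g x =
     (if \<exists>n. run c g (prod_encode (x, n)) = Some 0 \<and>
             (\<forall>m<n. run c g (prod_encode (x, m)) \<noteq> None)
      then Some (LEAST n. run c g (prod_encode (x, n)) = Some 0) else None)"

primrec goedel :: "code \<Rightarrow> nat" where
  "goedel Zero = 0"
| "goedel Succ = 1"
| "goedel Fst = 2"
| "goedel Snd = 3"
| "goedel Oracle = 4"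
| "goedel (Pair c d) = 5 + 4 * prod_encode (goedel c, goedel d)"
| "goedel (Comp c d) = 6 + 4 * prod_encode (goedel c, goedel d)"
| "goedel (Prec c d) = 7 + 4 * prod_encode (goedel c, goedel d)"
| "goedel (Mu c) = 8 + 4 * goedel c"

lemma inj_goedel: "goedel c = goedel d \<Longrightarrow> c = d"
proof (induction c arbitrary: d)
  case Zero then show ?case by (cases d) auto
next
  case Succ then show ?case by (cases d) auto
next
  case Fst then show ?case by (cases d) auto
next
  case Snd then show ?case by (cases d) auto
next
  case Oracle then show ?case by (cases d) auto
next
  case (Pair c1 c2) then show ?case by (cases d) (auto, presburger+)
next
  case (Comp c1 c2) then show ?case by (cases d) (auto, presburger+)
next
  case (Prec c1 c2) then show ?case by (cases d) (auto, presburger+)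
next
  case (Mu c) then show ?case by (cases d) (auto, presburger+)
qed

lemma surj_goedel: "\<exists>c. goedel c = n"
proof (induction n rule: less_induct)
  case (less n)
  show ?case
  proof (cases "n < 5")
    case True
    then have "n = 0 \<or> n = 1 \<or> n = 2 \<or> n = 3 \<or> n = 4" by auto
    then show ?thesis using goedel.simps(1-5) by metis
  next
    case False
    define k where "k = (n - 5) div 4"
    obtain a b where ab: "prod_encode (a, b) = k"
      by (metis prod_decode_inverse surj_pair)
    have "k < n" using False by (auto simp: k_def)
    moreover have "a \<le> k" "b \<le> k" using le_prod_encode_1 le_prod_encode_2 ab by metis+
    ultimately have "a < n" "b < n" by auto
    with less \<open>k < n\<close> obtain c d e where e: "goedel c = a" "goedel d = b" "goedel e = k" by metis
    have "n = 5 + 4 * k \<or> n = 6 + 4 * k \<or> n = 7 + 4 * k \<or> n = 8 + 4 * k"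
      using False unfolding k_def by presburger
    then show ?thesis using e ab goedel.simps(6-9) by metis
  qed
qed

lemma bij_goedel: "bij goedel"
  using inj_goedel surj_goedel by (metis bijI injI surjI)

definition program :: "nat \<Rightarrow> code" where
  "program = inv goedel"

definition Phi :: "nat \<Rightarrow> (nat \<Rightarrow> nat) \<Rightarrow> (nat \<Rightarrow> nat) option" where
  "Phi e g =
     (if \<forall>n. run (program e) g n \<noteq> None then Some (\<lambda>n. the (run (program e) g n)) else None)"

text \<open>Oracle-free computability is computability relative to the zero oracle.\<close>

definition computable :: "(nat \<Rightarrow> nat) \<Rightarrow> bool" where
  "computable f \<longleftrightarrow> (\<exists>c. \<forall>x. run c (\<lambda>_. 0) x = Some (f x))"

definition special :: "(nat \<Rightarrow> nat) set \<Rightarrow> bool" where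
  "special P \<longleftrightarrow> P \<noteq> {} \<and> (\<forall>f\<in>P. \<not> computable f)"

definition cantor :: "(nat \<Rightarrow> nat) set" where
  "cantor = {f. range f \<subseteq> {0, 1}}"

definition computable_rel :: "(nat \<Rightarrow> (nat \<Rightarrow> nat) \<Rightarrow> bool) \<Rightarrow> bool" where
  "computable_rel R \<longleftrightarrow> (\<exists>c. \<forall>g n. run c g n = Some (if R n g then 1 else 0))"

definition Pi01 :: "(nat \<Rightarrow> nat) set \<Rightarrow> bool" where
  "Pi01 P \<longleftrightarrow> (\<exists>R. computable_rel R \<and> P = {g. \<forall>n. R n g})"

text \<open>
  No effective listing consists of exactly the total computable functions, so learners are indexed
  by the programs computing them: \<open>learner_index e \<psi>\<close> says that program \<open>e\<close> is total on (codes of)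
  finite sequences and computes the learner \<open>\<psi>\<close>. Every learner has an index, and an index
  determines its learner.
\<close>

definition learner_index :: "nat \<Rightarrow> (nat list \<Rightarrow> nat) \<Rightarrow> bool" where
  "learner_index e \<psi> \<longleftrightarrow> (\<forall>\<sigma>. run (program e) (\<lambda>_. 0) (list_encode \<sigma>) = Some (\<psi> \<sigma>))"

definition learner :: "(nat list \<Rightarrow> nat) \<Rightarrow> bool" where
  "learner \<psi> \<longleftrightarrow> (\<exists>e. learner_index e \<psi>)"

definition prefix_of :: "(nat \<Rightarrow> nat) \<Rightarrow> nat \<Rightarrow> nat list" where
  "prefix_of g n = map g [0..<n]"

type_synonym functional = "(nat \<Rightarrow> nat) \<Rightarrow> (nat \<Rightarrow> nat) option"

definition identifies :: "(nat list \<Rightarrow> nat) \<Rightarrow> functional \<Rightarrow> (nat \<Rightarrow> nat) \<Rightarrow> bool" where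
  "identifies \<psi> \<Gamma> g \<longleftrightarrow>
     convergent (\<lambda>n. \<psi> (prefix_of g n)) \<and> Phi (lim (\<lambda>n. \<psi> (prefix_of g n))) g = \<Gamma> g"

definition one_omega_computable :: "functional \<Rightarrow> bool" where
  "one_omega_computable \<Gamma> \<longleftrightarrow> (\<exists>\<psi>. learner \<psi> \<and> (\<forall>g\<in>dom \<Gamma>. identifies \<psi> \<Gamma> g))"

definition fin_omega_computable :: "functional \<Rightarrow> bool" where
  "fin_omega_computable \<Gamma> \<longleftrightarrow>
     (\<exists>b. \<forall>g\<in>dom \<Gamma>. \<exists>e<b. \<exists>\<psi>. learner_index e \<psi> \<and> identifies \<psi> \<Gamma> g)"

definition reducible_by ::
  "(functional \<Rightarrow> bool) \<Rightarrow> (nat \<Rightarrow> nat) set \<Rightarrow> (nat \<Rightarrow> nat) set \<Rightarrow> bool" where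
  "reducible_by K A B \<longleftrightarrow> (\<exists>\<Gamma>. K \<Gamma> \<and> B \<subseteq> dom \<Gamma> \<and> (\<forall>g\<in>B. the (\<Gamma> g) \<in> A))"

definition le_one_omega :: "(nat \<Rightarrow> nat) set \<Rightarrow> (nat \<Rightarrow> nat) set \<Rightarrow> bool" where
  "le_one_omega = reducible_by one_omega_computable"

definition less_one_omega :: "(nat \<Rightarrow> nat) set \<Rightarrow> (nat \<Rightarrow> nat) set \<Rightarrow> bool" where
  "less_one_omega A B \<longleftrightarrow> le_one_omega A B \<and> \<not> le_one_omega B A"

definition le_fin_omega :: "(nat \<Rightarrow> nat) set \<Rightarrow> (nat \<Rightarrow> nat) set \<Rightarrow> bool" where
  "le_fin_omega = reducible_by fin_omega_computable"

definition equiv_fin_omega :: "(nat \<Rightarrow> nat) set \<Rightarrow> (nat \<Rightarrow> nat) set \<Rightarrow> bool" where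
  "equiv_fin_omega A B \<longleftrightarrow> le_fin_omega A B \<and> le_fin_omega B A"

end

theory Submission
  imports Defs
begin

text \<open>
  Read \<open>g\<close> in blocks \<open>g (3 j), g (3 j + 1), g (3 j + 2)\<close>, the \<open>j\<close>-th block carrying the bit
  \<open>g (3 j + 2)\<close> and having kind \<open>g (3 j) + g (3 j + 1)\<close>, which is \<open>0\<close>, \<open>1\<close> or \<open>2\<close>. The stack of kind
  \<open>k\<close> collects the bits of the blocks of kind \<open>k\<close> and is emptied by every block of larger kind; \<open>Q\<close>
  requires all stacks to stay in a computable tree of \<open>P\<close>. If \<open>k\<close> is the largest kind occurring
  infinitely often in \<open>g \<in> Q\<close>, then the final stack of kind \<open>k\<close> is a member of \<open>P\<close>, and it is found by
  a learner that knows \<open>k\<close> and waits for the last block of larger kind. So three learners suffice.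

  One learner does not suffice. By a Baire category argument its guess would be constant, with value
  \<open>e\<close>, on the part of a suitable closed subset of \<open>Q\<close> above some string. One block of kind \<open>2\<close> empties
  the stack of kind \<open>1\<close>. From there on, append blocks of kind \<open>0\<close> inside the tree until
  \<open>\<Phi>\<^sub>e\<close> outputs its next bit \<open>y\<close>, then append a block of kind \<open>1\<close> with bit \<open>y\<close>, and repeat. The stack of
  kind \<open>1\<close> is then an initial segment of the output of \<open>\<Phi>\<^sub>e\<close>, hence of a member of \<open>P\<close>, so the
  construction never gets stuck; it computes a member of \<open>P\<close>, and \<open>P\<close> was special.
\<close>

section \<open>Recursive functionals and bounded evaluation\<close>

definition proj1 :: "nat \<Rightarrow> nat" where "proj1 x = fst (prod_decode x)"
definition proj2 :: "nat \<Rightarrow> nat" where "proj2 x = snd (prod_decode x)"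

lemma proj1_pair [simp]: "proj1 (prod_encode (a, b)) = a" by (simp add: proj1_def)
lemma proj2_pair [simp]: "proj2 (prod_encode (a, b)) = b" by (simp add: proj2_def)
lemma pair_proj [simp]: "prod_encode (proj1 x, proj2 x) = x" by (simp add: proj1_def proj2_def)

lemma run_Prec:
  "run (Prec c d) g x = rec_nat (run c g (proj1 x))
     (\<lambda>k r. Option.bind r (\<lambda>v. run d g (prod_encode (proj1 x, prod_encode (k, v))))) (proj2 x)"
  by (simp add: proj1_def proj2_def split_def Let_def)

definition recursive :: "((nat \<Rightarrow> nat) \<Rightarrow> nat \<Rightarrow> nat) \<Rightarrow> bool" where
  "recursive F \<longleftrightarrow> (\<exists>c. \<forall>g x. run c g x = Some (F g x))"

abbreviation decidable :: "((nat \<Rightarrow> nat) \<Rightarrow> nat \<Rightarrow> bool) \<Rightarrow> bool" where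
  "decidable P \<equiv> recursive (\<lambda>g x. of_bool (P g x))"

lemma recursiveI: "(\<And>g x. run c g x = Some (F g x)) \<Longrightarrow> recursive F"
  by (auto simp: recursive_def)

lemma recursive_id: "recursive (\<lambda>g x. x)"
  by (rule recursiveI [of "Pair Fst Snd"]) simp

lemma recursive_compose:
  assumes "recursive F" "recursive A"
  shows "recursive (\<lambda>g x. F g (A g x))"
proof -
  from assms obtain f a where "\<And>g x. run f g x = Some (F g x)" "\<And>g x. run a g x = Some (A g x)"
    by (auto simp: recursive_def)
  then show ?thesis by (intro recursiveI [of "Comp f a"]) simp
qed

lemma recursive_Suc: "recursive A \<Longrightarrow> recursive (\<lambda>g x. Suc (A g x))"
  by (rule recursive_compose, rule recursiveI [of Succ], auto)

lemma recursive_proj1: "recursive A \<Longrightarrow> recursive (\<lambda>g x. proj1 (A g x))"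
  by (rule recursive_compose, rule recursiveI [of Fst], auto simp: proj1_def)

lemma recursive_proj2: "recursive A \<Longrightarrow> recursive (\<lambda>g x. proj2 (A g x))"
  by (rule recursive_compose, rule recursiveI [of Snd], auto simp: proj2_def)

lemma recursive_oracle: "recursive A \<Longrightarrow> recursive (\<lambda>g x. g (A g x))"
  by (rule recursive_compose [where F = "\<lambda>g x. g x"], rule recursiveI [of Oracle], auto)

lemma recursive_pair:
  assumes "recursive A" "recursive B"
  shows "recursive (\<lambda>g x. prod_encode (A g x, B g x))"
proof -
  from assms obtain a b where "\<And>g x. run a g x = Some (A g x)" "\<And>g x. run b g x = Some (B g x)"
    by (auto simp: recursive_def)
  then show ?thesis by (intro recursiveI [of "Pair a b"]) simp
qed

primrec numeral_code :: "nat \<Rightarrow> code" where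
  "numeral_code 0 = Zero"
| "numeral_code (Suc n) = Comp Succ (numeral_code n)"

lemma run_numeral_code [simp]: "run (numeral_code n) g x = Some n"
  by (induction n) auto

lemma recursive_const: "recursive (\<lambda>g x. n)"
  by (rule recursiveI [of "numeral_code n"]) simp

text \<open>The parameter \<open>x\<close> is kept whole, so base, step and number of rounds may all
  depend on it. \<open>Prec\<close> hands its step code the nested pair of parameter, counter and
  previous value, hence the coded form of the last assumption.\<close>

lemma recursive_rec:
  assumes "recursive A" "recursive N"
    and "recursive (\<lambda>g z. S g (proj1 z) (proj1 (proj2 z)) (proj2 (proj2 z)))"
  shows "recursive (\<lambda>g x. rec_nat (A g x) (S g x) (N g x))"
proof -
  from assms obtain a n s where
    a: "\<And>g x. run a g x = Some (A g x)" and n: "\<And>g x. run n g x = Some (N g x)" and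
    s: "\<And>g z. run s g z = Some (S g (proj1 z) (proj1 (proj2 z)) (proj2 (proj2 z)))"
    by (auto simp: recursive_def)
  have *: "rec_nat (Some (A g x)) (\<lambda>k r. Option.bind r (\<lambda>v. run s g (prod_encode (x, prod_encode (k, v))))) m
      = Some (rec_nat (A g x) (S g x) m)" for g x m
    by (induction m) (auto simp: s)
  show ?thesis
    by (rule recursiveI [of "Comp (Prec a s) (Pair (Pair Fst Snd) n)"])
       (simp add: run_Prec a n * del: run.simps(8))
qed

text \<open>A case distinction is a recursion of length 0 or 1 whose step ignores the previous
  value.\<close>

lemma recursive_if:
  assumes "decidable P" "recursive A" "recursive B"
  shows "recursive (\<lambda>g x. if P g x then A g x else B g x)"
proof -
  have "recursive (\<lambda>g x. rec_nat (B g x) (\<lambda>k r. A g x) (of_bool (P g x)))"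
    using assms(1)
    by (intro recursive_rec recursive_compose [OF assms(2)] recursive_compose [OF assms(3)]
        recursive_proj1 recursive_id)
  moreover have "rec_nat b (\<lambda>k r. a) (of_bool p) = (if p then a else b)" for p and a b :: nat
    by simp
  ultimately show ?thesis by simp
qed

lemma recursive_add:
  assumes "recursive A" "recursive B"
  shows "recursive (\<lambda>g x. A g x + B g x)"
proof -
  have "recursive (\<lambda>g x. rec_nat (A g x) (\<lambda>k r. Suc r) (B g x))"
    by (intro recursive_rec recursive_Suc recursive_proj2 recursive_id assms)
  moreover have "rec_nat a (\<lambda>k r. Suc r) b = a + b" for a b :: nat
    by (induction b) auto
  ultimately show ?thesis by simp
qed

lemma recursive_mult:
  assumes "recursive A" "recursive B"
  shows "recursive (\<lambda>g x. A g x * B g x)"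
proof -
  have "recursive (\<lambda>g x. rec_nat 0 (\<lambda>k r. A g x + r) (B g x))"
    by (intro recursive_rec recursive_add recursive_const recursive_compose [OF assms(1)]
        recursive_proj1 recursive_proj2 recursive_id assms)
  moreover have "rec_nat 0 (\<lambda>k r. a + r) b = a * b" for a b :: nat
    by (induction b) auto
  ultimately show ?thesis by simp
qed

lemma recursive_diff:
  assumes "recursive A" "recursive B"
  shows "recursive (\<lambda>g x. A g x - B g x)"
proof -
  have pred: "recursive (\<lambda>g x. rec_nat 0 (\<lambda>k r. k) x)"
    by (intro recursive_rec recursive_const recursive_proj1 recursive_proj2 recursive_id)
  have "recursive (\<lambda>g x. rec_nat (A g x) (\<lambda>k r. rec_nat 0 (\<lambda>k r. k) r) (B g x))"
    by (intro recursive_rec recursive_compose [OF pred] recursive_proj2 recursive_id assms)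
  moreover have "rec_nat 0 (\<lambda>k r. k) r = r - 1" for r :: nat
    by (cases r) auto
  moreover have "rec_nat a (\<lambda>k r. r - 1) b = a - b" for a b :: nat
    by (induction b) auto
  ultimately show ?thesis by simp
qed

section \<open>Decidable predicates and unbounded search\<close>

lemma decidable_not:
  assumes "decidable P"
  shows "decidable (\<lambda>g x. \<not> P g x)"
proof -
  have "recursive (\<lambda>g x. 1 - of_bool (P g x))"
    by (intro recursive_diff recursive_const assms)
  moreover have "1 - of_bool p = (of_bool (\<not> p) :: nat)" for p
    by simp
  ultimately show ?thesis by (simp only:)
qed

lemma decidable_conj:
  assumes "decidable P" "decidable R"
  shows "decidable (\<lambda>g x. P g x \<and> R g x)"
  unfolding of_bool_conj by (intro recursive_mult assms)

lemma decidable_imp: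
  assumes "decidable P" "decidable R"
  shows "decidable (\<lambda>g x. P g x \<longrightarrow> R g x)"
  using decidable_not [OF decidable_conj [OF assms(1) decidable_not [OF assms(2)]]] by simp

lemma decidable_less:
  assumes "recursive A" "recursive B"
  shows "decidable (\<lambda>g x. A g x < B g x)"
proof -
  have "recursive (\<lambda>g x. 1 - (1 - (B g x - A g x)))"
    by (intro recursive_diff recursive_const assms)
  moreover have "1 - (1 - (b - a)) = of_bool (a < b)" for a b :: nat
    by (cases "a < b") auto
  ultimately show ?thesis by simp
qed

lemma decidable_le:
  assumes "recursive A" "recursive B"
  shows "decidable (\<lambda>g x. A g x \<le> B g x)"
  unfolding not_less [symmetric] by (intro decidable_not decidable_less assms)

lemma decidable_eq:
  fixes A :: "(nat \<Rightarrow> nat) \<Rightarrow> nat \<Rightarrow> nat"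
  assumes "recursive A" "recursive B"
  shows "decidable (\<lambda>g x. A g x = B g x)"
  unfolding eq_iff by (intro decidable_conj decidable_le assms)

text \<open>The truth values are multiplied up along a primitive recursion.\<close>

lemma decidable_all_less:
  assumes "decidable (\<lambda>g z. P g (proj1 z) (proj2 z))" "recursive N"
  shows "decidable (\<lambda>g x. \<forall>n<N g x. P g x n)"
proof -
  have "recursive (\<lambda>g x. rec_nat 1 (\<lambda>k r. r * of_bool (P g x k)) (N g x))"
  proof (intro recursive_rec recursive_mult recursive_const assms(2))
    show "decidable (\<lambda>g z. P g (proj1 z) (proj1 (proj2 z)))"
      using recursive_compose [OF assms(1), of "\<lambda>g z. prod_encode (proj1 z, proj1 (proj2 z))"]
      by (simp add: recursive_pair recursive_proj1 recursive_proj2 recursive_id)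
  qed (intro recursive_proj2 recursive_id)
  moreover have "rec_nat 1 (\<lambda>k r. r * of_bool (p k)) n = (of_bool (\<forall>k<n. p k) :: nat)" for p n
    by (induction n) (auto simp: less_Suc_eq)
  ultimately show ?thesis by simp
qed

text \<open>\<open>Mu\<close> looks for the value 0, so the truth value is flipped. As the resulting
  code is total, the proviso of \<open>Mu\<close> on earlier values holds automatically.\<close>

lemma mu_code:
  assumes "decidable (\<lambda>g z. P g (proj1 z) (proj2 z))"
  obtains c where "\<And>g x. run c g x = (if \<exists>n. P g x n then Some (LEAST n. P g x n) else None)"
proof -
  have "recursive (\<lambda>g z. 1 - of_bool (P g (proj1 z) (proj2 z)))"
    by (intro recursive_diff recursive_const assms)
  then obtain c where c: "\<And>g z. run c g z = Some (1 - of_bool (P g (proj1 z) (proj2 z)))"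
    unfolding recursive_def by blast
  have "run (Mu c) g x = (if \<exists>n. P g x n then Some (LEAST n. P g x n) else None)" for g x
    by (simp add: c)
  then show ?thesis by (rule that)
qed

lemma recursive_Least:
  assumes "decidable (\<lambda>g z. P g (proj1 z) (proj2 z))" "\<And>g x. \<exists>n. P g x n"
  shows "recursive (\<lambda>g x. LEAST n. P g x n)"
  using mu_code [OF assms(1)] assms(2) by (metis recursiveI)

lemma recursive_div:
  assumes "recursive A" "0 < n"
  shows "recursive (\<lambda>g x. A g x div n)"
proof -
  have "recursive (\<lambda>g x. LEAST q. x < n * Suc q)"
  proof (rule recursive_Least)
    show "decidable (\<lambda>g z. proj1 z < n * Suc (proj2 z))"
      by (intro decidable_less recursive_mult recursive_const recursive_Suc recursive_proj1
          recursive_proj2 recursive_id)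
    show "\<exists>q. x < n * Suc q" for x
      using assms(2) by (intro exI [of _ x]) (cases n, auto)
  qed
  moreover have "(LEAST q. x < n * Suc q) = x div n" for x
  proof (rule Least_equality)
    show "x < n * Suc (x div n)" using dividend_less_times_div [OF assms(2)] by simp
    show "x div n \<le> q" if "x < n * Suc q" for q
      using that assms(2) by (metis less_Suc_eq_le less_mult_imp_div_less mult.commute)
  qed
  ultimately show ?thesis using recursive_compose [OF _ assms(1)] by simp
qed

text \<open>Oracle substitution: the new oracle may depend on a parameter, passed as first component.\<close>

primrec subst_oracle :: "code \<Rightarrow> code \<Rightarrow> code" where
  "subst_oracle h Zero = Zero"
| "subst_oracle h Succ = Comp Succ Snd"
| "subst_oracle h Fst = Comp Fst Snd"
| "subst_oracle h Snd = Comp Snd Snd"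
| "subst_oracle h Oracle = h"
| "subst_oracle h (Pair c d) = Pair (subst_oracle h c) (subst_oracle h d)"
| "subst_oracle h (Comp c d) = Comp (subst_oracle h c) (Pair Fst (subst_oracle h d))"
| "subst_oracle h (Prec c d) =
     Comp (Prec (subst_oracle h c)
        (Comp (subst_oracle h d) (Pair (Comp Fst Fst) (Pair (Comp Snd Fst) Snd))))
       (Pair (Pair Fst (Comp Fst Snd)) (Comp Snd Snd))"
| "subst_oracle h (Mu c) =
     Mu (Comp (subst_oracle h c) (Pair (Comp Fst Fst) (Pair (Comp Snd Fst) Snd)))"

text \<open>Every translated code finds the parameter \<open>p\<close> in front of its input. The
  pairings in the clauses for \<open>Prec\<close> and \<open>Mu\<close> only move \<open>p\<close>
  back to the front after these have packed their own arguments.\<close>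

lemma run_subst_oracle:
  assumes h: "\<And>g z. run h g z = Some (H g (proj1 z) (proj2 z))"
  shows "run (subst_oracle h c) g (prod_encode (p, x)) = run c (H g p) x"
proof (induction c arbitrary: x)
  case (Comp c d)
  then show ?case by (cases "run d (H g p) x") auto
next
  case (Pair c d)
  then show ?case by simp
next
  case (Prec c d)
  then show ?case by (simp add: proj1_def proj2_def split_def Let_def)
next
  case (Mu c)
  then show ?case by simp
qed (simp_all add: h)

text \<open>Lets a functional run on an oracle that is itself computed from the input, such as the
  sequence coded by a number; \<open>x\<close> is the parameter of the substituted oracle.\<close>

lemma recursive_subst:
  assumes "recursive F" "recursive (\<lambda>g z. H g (proj1 z) (proj2 z))" "recursive N"
  shows "recursive (\<lambda>g x. F (H g x) (N g x))"
proof -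
  from assms obtain f h n where
    f: "\<And>g x. run f g x = Some (F g x)" and h: "\<And>g z. run h g z = Some (H g (proj1 z) (proj2 z))" and
    n: "\<And>g x. run n g x = Some (N g x)"
    by (auto simp: recursive_def)
  show ?thesis
    by (rule recursiveI [of "Comp (subst_oracle h f) (Pair (Pair Fst Snd) n)"])
       (simp add: f n run_subst_oracle [where H = H, OF h])
qed

lemmas recursive_intros = recursive_id recursive_Suc recursive_proj1 recursive_proj2 recursive_oracle
  recursive_pair recursive_rec recursive_if recursive_add recursive_mult recursive_diff
  decidable_not decidable_conj decidable_imp decidable_less decidable_le decidable_eq
  decidable_all_less

text \<open>
  The result \<open>0\<close> means undefined and \<open>Suc y\<close> means value \<open>y\<close>. Both the oracle queries and the
  unbounded searches are cut off at \<open>L\<close>, so that the result is total, computable, and depends only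
  on \<open>g\<close> below \<open>L\<close>.
\<close>

primrec bounded_run :: "code \<Rightarrow> (nat \<Rightarrow> nat) \<Rightarrow> nat \<Rightarrow> nat \<Rightarrow> nat" where
  "bounded_run Zero g L x = 1"
| "bounded_run Succ g L x = Suc (Suc x)"
| "bounded_run Fst g L x = Suc (proj1 x)"
| "bounded_run Snd g L x = Suc (proj2 x)"
| "bounded_run Oracle g L x = (if x < L then Suc (g x) else 0)"
| "bounded_run (Pair c d) g L x =
     (if bounded_run c g L x = 0 then 0 else if bounded_run d g L x = 0 then 0
      else Suc (prod_encode (bounded_run c g L x - 1, bounded_run d g L x - 1)))"
| "bounded_run (Comp c d) g L x = (if bounded_run d g L x = 0 then 0 else bounded_run c g L (bounded_run d g L x - 1))"
| "bounded_run (Prec c d) g L x =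
     rec_nat (bounded_run c g L (proj1 x))
       (\<lambda>k r. if r = 0 then 0 else bounded_run d g L (prod_encode (proj1 x, prod_encode (k, r - 1)))) (proj2 x)"
| "bounded_run (Mu c) g L x =
     (let n = (LEAST n. n < L \<longrightarrow> bounded_run c g L (prod_encode (x, n)) \<le> 1)
      in if n < L \<and> bounded_run c g L (prod_encode (x, n)) = 1 then Suc n else 0)"

lemma recursive_bounded_run_aux: "recursive (\<lambda>g z. bounded_run c g (proj1 z) (proj2 z))"
proof (induction c)
  case (Pair c d)
  then show ?case unfolding bounded_run.simps
    by (intro recursive_intros recursive_const)
next
  case (Comp c d)
  have "recursive (\<lambda>g z. bounded_run c g (proj1 z) (bounded_run d g (proj1 z) (proj2 z) - 1))"
    using recursive_compose [OF Comp.IH(1), of "\<lambda>g z. prod_encode (proj1 z, bounded_run d g (proj1 z) (proj2 z) - 1)"] Comp.IH(2)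
    by (simp add: recursive_intros recursive_const)
  with Comp.IH(2) show ?case unfolding bounded_run.simps
    by (intro recursive_intros recursive_const)
next
  case (Prec c d)
  have c: "recursive (\<lambda>g z. bounded_run c g (proj1 z) (proj1 (proj2 z)))"
    using recursive_compose [OF Prec.IH(1), of "\<lambda>g z. prod_encode (proj1 z, proj1 (proj2 z))"]
    by (simp add: recursive_intros)
  have d: "recursive (\<lambda>g z. bounded_run d g (proj1 (proj1 z)) (prod_encode (proj1 (proj2 (proj1 z)), prod_encode (proj1 (proj2 z), proj2 (proj2 z) - 1))))"
    using recursive_compose [OF Prec.IH(2), of "\<lambda>g z. prod_encode (proj1 (proj1 z), prod_encode (proj1 (proj2 (proj1 z)), prod_encode (proj1 (proj2 z), proj2 (proj2 z) - 1)))"]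
    by (simp add: recursive_intros recursive_const)
  show ?case unfolding bounded_run.simps
    by (intro recursive_intros recursive_const c d)
next
  case (Mu c)
  have c: "recursive (\<lambda>g z. bounded_run c g (proj1 (proj1 z)) (prod_encode (proj2 (proj1 z), proj2 z)))"
    using recursive_compose [OF Mu.IH, of "\<lambda>g z. prod_encode (proj1 (proj1 z), prod_encode (proj2 (proj1 z), proj2 z))"]
    by (simp add: recursive_intros)
  \<comment> \<open>The guard is void at \<open>n = proj1 z\<close>, so this search always
    ends.\<close>
  have m: "recursive (\<lambda>g z. LEAST n. n < proj1 z \<longrightarrow> bounded_run c g (proj1 z) (prod_encode (proj2 z, n)) \<le> 1)"
    by (rule recursive_Least) (intro recursive_intros recursive_const c, blast)
  have e: "recursive (\<lambda>g z. bounded_run c g (proj1 z) (prod_encode (proj2 z, LEAST n. n < proj1 z \<longrightarrow> bounded_run c g (proj1 z) (prod_encode (proj2 z, n)) \<le> 1)))"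
    using recursive_compose [OF c recursive_pair [OF recursive_id m]] by simp
  show ?case unfolding bounded_run.simps Let_def
    by (intro recursive_intros recursive_const m e)
qed (unfold bounded_run.simps, (intro recursive_intros recursive_const)+)

lemma bounded_run_cong:
  assumes "\<And>i. i < L \<Longrightarrow> g i = h i"
  shows "bounded_run c g L x = bounded_run c h L x"
  by (induction c arbitrary: x) (simp_all add: assms cong: if_cong)

lemma bounded_run_sound: "bounded_run c g L x = Suc y \<Longrightarrow> run c g x = Some y"
proof (induction c arbitrary: x y)
  case (Pair c d)
  then show ?case by (auto split: if_splits simp: gr0_conv_Suc)
next
  case (Comp c d)
  then show ?case by (auto split: if_splits simp: gr0_conv_Suc)
next
  case (Prec c d)
  have "rec_nat (bounded_run c g L (proj1 x)) (\<lambda>k r. if r = 0 then 0 else bounded_run d g L (prod_encode (proj1 x, prod_encode (k, r - 1)))) n = Suc y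
    \<Longrightarrow> rec_nat (run c g (proj1 x)) (\<lambda>k r. Option.bind r (\<lambda>v. run d g (prod_encode (proj1 x, prod_encode (k, v))))) n = Some y" for n y
    by (induction n arbitrary: y) (auto split: if_splits simp: gr0_conv_Suc Prec.IH)
  with Prec.prems show ?case by (simp add: run_Prec del: run.simps)
next
  case (Mu c)
  define n where "n = (LEAST n. n < L \<longrightarrow> bounded_run c g L (prod_encode (x, n)) \<le> 1)"
  have n: "n < L" "bounded_run c g L (prod_encode (x, n)) = 1" "y = n"
    using Mu.prems unfolding bounded_run.simps Let_def n_def [symmetric] by (auto split: if_splits)
  \<comment> \<open>Before the least \<open>n\<close> the bounded value is neither 0 (undefined) nor
    1 (value 0), so the true search passes these places as well.\<close>
  have less: "\<exists>v. run c g (prod_encode (x, m)) = Some (Suc v)" if "m < n" for m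
  proof -
    have "bounded_run c g L (prod_encode (x, m)) > 1" using not_less_Least [OF that [unfolded n_def]] by auto
    then obtain v where "bounded_run c g L (prod_encode (x, m)) = Suc (Suc v)"
      by (auto dest: less_imp_Suc_add)
    then show ?thesis using Mu.IH by blast
  qed
  have z: "run c g (prod_encode (x, n)) = Some 0" using Mu.IH n by auto
  have "(LEAST n. run c g (prod_encode (x, n)) = Some 0) = n"
    using z less by (intro Least_equality) (auto, metis leI nat.distinct(1) option.inject)
  moreover have "\<exists>n. run c g (prod_encode (x, n)) = Some 0 \<and> (\<forall>m<n. run c g (prod_encode (x, m)) \<noteq> None)"
    using z less by fastforce
  ultimately show ?case using n by simp
qed (auto simp: proj1_def proj2_def split: if_splits)

text \<open>Asserting this for all large \<open>L\<close>, not just for some, lets the thresholds of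
  the finitely many subcomputations be combined.\<close>

lemma bounded_run_complete: "run c g x = Some y \<Longrightarrow> \<forall>\<^sub>F L in sequentially. bounded_run c g L x = Suc y"
proof (induction c arbitrary: x y)
  case Oracle
  then show ?case using eventually_gt_at_top [of x] by (auto elim: eventually_mono)
next
  case (Pair c d)
  then obtain u v where "run c g x = Some u" "run d g x = Some v" "y = prod_encode (u, v)"
    by (auto simp: bind_eq_Some_conv)
  with Pair.IH(1) [of x u] Pair.IH(2) [of x v] show ?case
    by (auto elim: eventually_elim2)
next
  case (Comp c d)
  then obtain u where "run d g x = Some u" "run c g u = Some y"
    by (auto simp: bind_eq_Some_conv)
  with Comp.IH(1) [of u y] Comp.IH(2) [of x u] show ?case
    by (auto elim: eventually_elim2)
next
  case (Prec c d)
  have "rec_nat (run c g (proj1 x)) (\<lambda>k r. Option.bind r (\<lambda>v. run d g (prod_encode (proj1 x, prod_encode (k, v))))) n = Some y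
    \<Longrightarrow> \<forall>\<^sub>F L in sequentially. rec_nat (bounded_run c g L (proj1 x)) (\<lambda>k r. if r = 0 then 0 else bounded_run d g L (prod_encode (proj1 x, prod_encode (k, r - 1)))) n = Suc y" for n y
  proof (induction n arbitrary: y)
    case 0
    then show ?case using Prec.IH by simp
  next
    case (Suc n)
    from Suc.prems obtain v where
      v: "rec_nat (run c g (proj1 x)) (\<lambda>k r. Option.bind r (\<lambda>v. run d g (prod_encode (proj1 x, prod_encode (k, v))))) n = Some v"
      and d: "run d g (prod_encode (proj1 x, prod_encode (n, v))) = Some y"
      by (auto simp: bind_eq_Some_conv)
    show ?case using Suc.IH [OF v] Prec.IH(2) [OF d] by (auto elim: eventually_elim2)
  qed
  with Prec.prems show ?case by (simp add: run_Prec del: run.simps)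
next
  case (Mu c)
  have ex: "\<exists>n. run c g (prod_encode (x, n)) = Some 0 \<and> (\<forall>m<n. run c g (prod_encode (x, m)) \<noteq> None)"
    and y: "y = (LEAST n. run c g (prod_encode (x, n)) = Some 0)"
    using Mu.prems by (auto split: if_splits)
  have y0: "run c g (prod_encode (x, y)) = Some 0" 
    unfolding y using ex by (auto intro: LeastI)
  have less: "\<exists>v. run c g (prod_encode (x, m)) = Some (Suc v)" if "m < y" for m
  proof -
    have "run c g (prod_encode (x, m)) \<noteq> Some 0" using that not_less_Least unfolding y by blast
    moreover have "run c g (prod_encode (x, m)) \<noteq> None"
    proof -
      obtain n where n: "run c g (prod_encode (x, n)) = Some 0"
        "\<forall>m<n. run c g (prod_encode (x, m)) \<noteq> None" using ex by blast
      have "y \<le> n" unfolding y using n(1) by (rule Least_le)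
      with n(2) that show ?thesis by simp
    qed
    ultimately show ?thesis by (metis not0_implies_Suc option.exhaust)
  qed
  have "\<forall>\<^sub>F L in sequentially. bounded_run c g L (prod_encode (x, m)) > 1" if m: "m \<in> {..<y}" for m
  proof -
    obtain v where "run c g (prod_encode (x, m)) = Some (Suc v)" using less m by auto
    from Mu.IH [OF this] show ?thesis by (auto elim: eventually_mono)
  qed
  then have "\<forall>\<^sub>F L in sequentially. \<forall>m\<in>{..<y}. bounded_run c g L (prod_encode (x, m)) > 1"
    by (intro eventually_ball_finite) auto
  with eventually_gt_at_top [of y] Mu.IH [OF y0]
  show ?case
  proof eventually_elim
    case (elim L)
    have "(LEAST n. n < L \<longrightarrow> bounded_run c g L (prod_encode (x, n)) \<le> 1) = y"
    proof (rule Least_equality)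
      fix n assume n: "n < L \<longrightarrow> bounded_run c g L (prod_encode (x, n)) \<le> 1"
      show "y \<le> n"
      proof (rule ccontr)
        assume "\<not> y \<le> n"
        with elim have "1 < bounded_run c g L (prod_encode (x, n))" "n < L" by auto
        with n show False by simp
      qed
    qed (use elim in simp)
    with elim show ?case by (simp add: Let_def)
  qed
qed (auto simp: proj1_def proj2_def)

section \<open>Blocks and stacks\<close>

text \<open>A nonempty list is coded by the successor of the pair of its head and the code of its
  tail; subtracting 1 uncovers the pair. The empty list, coded by 0, becomes its own tail, since 0
  codes the pair (0, 0).\<close>

definition ltail :: "nat \<Rightarrow> nat \<Rightarrow> nat" where
  "ltail w n = rec_nat w (\<lambda>k r. proj2 (r - 1)) n"

definition lnth :: "nat \<Rightarrow> nat \<Rightarrow> nat" where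
  "lnth w i = proj1 (ltail w i - 1)"

definition llen :: "nat \<Rightarrow> nat" where
  "llen w = (LEAST n. ltail w n = 0)"

lemma ltail_list_encode: "ltail (list_encode l) n = list_encode (drop n l)"
proof (induction n)
  case (Suc n)
  have "proj2 0 = 0" using proj2_pair [of 0 0] by (simp add: prod_encode_def)
  then have "proj2 (list_encode xs - 1) = list_encode (tl xs)" for xs
    by (cases xs) auto
  with Suc show ?case by (simp add: ltail_def drop_Suc tl_drop)
qed (simp add: ltail_def)

lemma list_encode_eq_0_iff: "list_encode l = 0 \<longleftrightarrow> l = []"
  by (cases l) auto

lemma lnth_list_encode: "i < length l \<Longrightarrow> lnth (list_encode l) i = l ! i"
  by (simp add: lnth_def ltail_list_encode flip: Cons_nth_drop_Suc)

lemma llen_list_encode [simp]: "llen (list_encode l) = length l"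
  unfolding llen_def ltail_list_encode list_encode_eq_0_iff drop_eq_Nil
  by (rule Least_equality) auto

lemma recursive_ltail:
  "recursive A \<Longrightarrow> recursive B \<Longrightarrow> recursive (\<lambda>g x. ltail (A g x) (B g x))"
  unfolding ltail_def by (intro recursive_intros recursive_const)

lemma recursive_lnth:
  "recursive A \<Longrightarrow> recursive B \<Longrightarrow> recursive (\<lambda>g x. lnth (A g x) (B g x))"
  unfolding lnth_def by (intro recursive_ltail recursive_intros recursive_const)

lemma recursive_llen:
  assumes "recursive A" shows "recursive (\<lambda>g x. llen (A g x))"
proof -
  have "recursive (\<lambda>g x. llen x)"
    unfolding llen_def
  proof (rule recursive_Least)
    show "\<exists>n. ltail x n = 0" for x
      using ltail_list_encode [of "list_decode x"] by (metis drop_all le_refl list_decode_inverse list_encode.simps(1))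
  qed (intro recursive_ltail recursive_intros recursive_const)
  from recursive_compose [OF this assms] show ?thesis .
qed

section \<open>Stacks of a sequence of blocks\<close>

definition kind :: "(nat \<Rightarrow> nat) \<Rightarrow> nat \<Rightarrow> nat" where "kind g j = g (3 * j) + g (3 * j + 1)"
definition letter :: "(nat \<Rightarrow> nat) \<Rightarrow> nat \<Rightarrow> nat" where "letter g j = g (3 * j + 2)"

primrec stack :: "nat \<Rightarrow> (nat \<Rightarrow> nat) \<Rightarrow> nat \<Rightarrow> nat list" where
  "stack k g 0 = []"
| "stack k g (Suc j) =
     (if k < kind g j then [] else if kind g j = k then stack k g j @ [letter g j] else stack k g j)"

text \<open>The place just after the last block of kind above \<open>k\<close> seen so far, or 0 if
  there was none. The current stack started empty there; this is what the learner for
  \<open>k\<close> guesses.\<close>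

primrec stack_base :: "nat \<Rightarrow> (nat \<Rightarrow> nat) \<Rightarrow> nat \<Rightarrow> nat" where
  "stack_base k g 0 = 0"
| "stack_base k g (Suc j) = (if k < kind g j then Suc j else stack_base k g j)"

lemma kind_cong: "(\<And>i. i < 3 * m \<Longrightarrow> g i = h i) \<Longrightarrow> j < m \<Longrightarrow> kind g j = kind h j"
  by (simp add: kind_def)

lemma stack_cong: "(\<And>i. i < 3 * m \<Longrightarrow> g i = h i) \<Longrightarrow> stack k g m = stack k h m"
  by (induction m) (simp_all add: kind_def letter_def)

lemma stack_base_cong: "(\<And>i. i < 3 * m \<Longrightarrow> g i = h i) \<Longrightarrow> stack_base k g m = stack_base k h m"
  by (induction m) (simp_all add: kind_def)

lemma recursive_kind: "recursive A \<Longrightarrow> recursive (\<lambda>g x. kind g (A g x))"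
  unfolding kind_def by (intro recursive_intros recursive_const)

lemma recursive_letter: "recursive A \<Longrightarrow> recursive (\<lambda>g x. letter g (A g x))"
  unfolding letter_def by (intro recursive_intros recursive_const)

lemma recursive_stack_base: "recursive (stack_base k)"
proof -
  have "recursive (\<lambda>g x. rec_nat 0 (\<lambda>j r. if k < kind g j then Suc j else r) x)"
    by (intro recursive_intros recursive_const recursive_kind)
  moreover have "rec_nat 0 (\<lambda>j r. if k < kind g j then Suc j else r) x = stack_base k g x" for g x
    by (induction x) auto
  ultimately show ?thesis by simp
qed

text \<open>A stack grows at the end of its list, whereas coded lists grow at the front; hence the
  reversal.\<close>

lemma recursive_stack:
  assumes "recursive A" shows "recursive (\<lambda>g x. list_encode (rev (stack k g (A g x))))"
proof -
  have "recursive (\<lambda>g x. rec_nat 0 (\<lambda>j r. if k < kind g j then 0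
      else if kind g j = k then Suc (prod_encode (letter g j, r)) else r) (A g x))"
    by (intro recursive_intros recursive_const recursive_kind recursive_letter assms)
  moreover have "rec_nat 0 (\<lambda>j r. if k < kind g j then 0
      else if kind g j = k then Suc (prod_encode (letter g j, r)) else r) x = list_encode (rev (stack k g x))" for g x
    by (induction x) auto
  ultimately show ?thesis by simp
qed

lemma stack_stack_base [simp]: "stack k g (stack_base k g m) = []"
  by (induction m) auto

lemma kind_le_after_stack_base: "stack_base k g m \<le> j \<Longrightarrow> j < m \<Longrightarrow> kind g j \<le> k"
  by (induction m) (auto split: if_splits simp: less_Suc_eq)

lemma stack_base_eventually_const:
  assumes "\<And>j. N \<le> j \<Longrightarrow> kind g j \<le> k" "N \<le> m"
  shows "stack_base k g m = stack_base k g N"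
  using assms(2)
proof (induction m rule: dec_induct)
  case (step m)
  then show ?case using assms(1) [of m] by simp
qed simp

text \<open>The bit on top when the height \<open>i + 1\<close> is first reached after block
  \<open>n\<close>. If the stack is empty at \<open>n\<close> and never emptied later, this is bit
  \<open>i\<close> of the final stack.\<close>

definition stack_bit :: "nat \<Rightarrow> (nat \<Rightarrow> nat) \<Rightarrow> nat \<Rightarrow> nat \<Rightarrow> nat" where
  "stack_bit k g n i = last (stack k g (n + (LEAST t. length (stack k g (n + t)) = Suc i)))"

lemma stack_bit_code:
  obtains c where "\<And>g n i. run c g (prod_encode (n, i)) =
    (if \<exists>t. length (stack k g (n + t)) = Suc i then Some (stack_bit k g n i) else None)"
proof -
  let ?l = "\<lambda>g z t. llen (list_encode (rev (stack k g (proj1 z + t))))"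
  have dec: "decidable (\<lambda>g z. ?l g (proj1 z) (proj2 z) = Suc (proj2 (proj1 z)))"
    by (intro recursive_intros recursive_llen recursive_stack)
  obtain s where s: "\<And>g z. run s g z =
      (if \<exists>t. ?l g z t = Suc (proj2 z) then Some (LEAST t. ?l g z t = Suc (proj2 z)) else None)"
    using mu_code [OF dec] by blast
  \<comment> \<open>Entry 0 of the reversed stack is its top.\<close>
  have "recursive (\<lambda>g z. lnth (list_encode (rev (stack k g (proj1 (proj1 z) + proj2 z)))) 0)"
    by (intro recursive_lnth recursive_stack recursive_intros recursive_const)
  then obtain d where d: "\<And>g z. run d g z = Some (lnth (list_encode (rev (stack k g (proj1 (proj1 z) + proj2 z)))) 0)"
    unfolding recursive_def by blast
  show ?thesis
  proof (rule that [of "Comp d (Pair (Pair Fst Snd) s)"], goal_cases)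
    case (1 g n i)
    show ?case
    proof (cases "\<exists>t. length (stack k g (n + t)) = Suc i")
      case True
      define t where "t = (LEAST t. length (stack k g (n + t)) = Suc i)"
      have "length (stack k g (n + t)) = Suc i" using LeastI_ex [OF True] by (simp add: t_def)
      then have "stack k g (n + t) \<noteq> []" by auto
      then show ?thesis using True
        by (simp add: s d stack_bit_def lnth_list_encode rev_nth last_conv_nth flip: t_def)
    qed (auto simp: s)
  qed
qed

section \<open>The learner for a given kind\<close>

lemma program_goedel [simp]: "program (goedel c) = c"
  unfolding program_def using bij_goedel by (simp add: bij_is_inj)

text \<open>Needed for the learner to compute the index of a program with a constant built in;
  \<open>6 + 4 * prod_encode (1, r)\<close> is the index of \<open>Comp Succ\<close> applied to the
  code with index \<open>r\<close>.\<close>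

lemma recursive_goedel_numeral_code:
  assumes "recursive A" shows "recursive (\<lambda>g x. goedel (numeral_code (A g x)))"
proof -
  have "recursive (\<lambda>g x. rec_nat 0 (\<lambda>k r. 6 + 4 * prod_encode (1, r)) (A g x))"
    by (intro recursive_intros recursive_const assms)
  moreover have "rec_nat 0 (\<lambda>k r. 6 + 4 * prod_encode (1, r)) n = goedel (numeral_code n)" for n
    by (induction n) auto
  ultimately show ?thesis by simp
qed

lemma prefix_of_simps [simp]: "length (prefix_of g n) = n" "i < n \<Longrightarrow> prefix_of g n ! i = g i"
  by (simp_all add: prefix_of_def)

lemma prefix_of_Suc: "prefix_of g (Suc n) = prefix_of g n @ [g n]"
  by (simp add: prefix_of_def)

lemma stack_grows:
  assumes "\<And>j. n \<le> j \<Longrightarrow> kind g j \<le> k" "n \<le> m"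
  shows "stack k g (Suc m) = (if kind g m = k then stack k g m @ [letter g m] else stack k g m)"
  using assms by (auto simp: not_less [symmetric])

lemma length_stack_mono:
  assumes "\<And>j. n \<le> j \<Longrightarrow> kind g j \<le> k" "n \<le> m" "m \<le> m'"
  shows "length (stack k g m) \<le> length (stack k g m')"
  using assms(3)
proof (induction m' rule: dec_induct)
  case (step m')
  with stack_grows [OF assms(1), of n m'] assms(2) show ?case by auto
qed simp

text \<open>From block \<open>n\<close> on nothing empties the stack, so the bit that first brings
  it to height \<open>i + 1\<close> stays at position \<open>i\<close>.\<close>

lemma stack_eq_prefix_of_stack_bit:
  assumes "\<And>j. n \<le> j \<Longrightarrow> kind g j \<le> k" "stack k g n = []"
  shows "stack k g (n + t) = prefix_of (stack_bit k g n) (length (stack k g (n + t)))"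
proof (induction t)
  case (Suc t)
  show ?case
  proof (cases "kind g (n + t) = k")
    case True
    let ?i = "length (stack k g (n + t))"
    have e: "stack k g (n + Suc t) = stack k g (n + t) @ [letter g (n + t)]"
      using stack_grows [OF assms(1), of n "n + t"] True by simp
    have "(LEAST s. length (stack k g (n + s)) = Suc ?i) = Suc t"
    proof (rule Least_equality)
      show "Suc t \<le> s" if "length (stack k g (n + s)) = Suc ?i" for s
        using length_stack_mono [OF assms(1), of n "n + s" "n + t"] that by (cases "s \<le> t") auto
    qed (use e in simp)
    then have "stack_bit k g n ?i = letter g (n + t)" using e by (simp add: stack_bit_def)
    with Suc e show ?thesis by (simp add: prefix_of_Suc)
  next
    case False
    then show ?thesis using stack_grows [OF assms(1), of n "n + t"] Suc by simp
  qed
qed (simp add: assms prefix_of_def)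

text \<open>The height changes only at blocks of kind \<open>k\<close>, and there by one. Passing to
  the next such block, which exists by infinitude, gives the next height.\<close>

lemma ex_length_stack_eq:
  assumes "\<And>j. n \<le> j \<Longrightarrow> kind g j \<le> k" "stack k g n = []" "infinite {j. kind g j = k}"
  shows "\<exists>t. length (stack k g (n + t)) = i"
proof (induction i)
  case 0
  show ?case by (rule exI [of _ 0]) (simp add: assms)
next
  case (Suc i)
  then obtain t where t: "length (stack k g (n + t)) = i" by blast
  have ex: "\<exists>j. n + t \<le> j \<and> kind g j = k"
    using assms(3) by (metis (mono_tags, lifting) finite_nat_set_iff_bounded linorder_not_less mem_Collect_eq)
  define j where "j = (LEAST j. n + t \<le> j \<and> kind g j = k)"
  have j: "n + t \<le> j" "kind g j = k" using LeastI_ex [OF ex] by (simp_all add: j_def)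
  have "stack k g m = stack k g (n + t)" if "n + t \<le> m" "m \<le> j" for m
    using that
  proof (induction m rule: dec_induct)
    case (step m)
    then have "kind g m \<noteq> k"
      using not_less_Least [of m "\<lambda>j. n + t \<le> j \<and> kind g j = k"] unfolding j_def by auto
    with step show ?case using stack_grows [OF assms(1), of n m] by simp
  qed simp
  from this [of j] j t have "length (stack k g (Suc j)) = Suc i"
    using stack_grows [OF assms(1), of n j] by simp
  moreover obtain s where "Suc j = n + s" using j(1) by (metis add_leE le_Suc_ex le_SucI)
  ultimately show ?case by metis
qed

text \<open>The learner guesses a program that reads the stack from \<open>stack_base\<close> on.
  Once the last block of larger kind has been seen the guess is fixed, and its program computes the
  final stack.\<close>

lemma identifying_learner:
  obtains e \<psi> where "learner_index e \<psi>"
    "\<And>g N. (\<And>j. N \<le> j \<Longrightarrow> kind g j \<le> k) \<Longrightarrow> infinite {j. kind g j = k} \<Longrightarrow>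
      convergent (\<lambda>n. \<psi> (prefix_of g n)) \<and>
      (\<exists>f. Phi (lim (\<lambda>n. \<psi> (prefix_of g n))) g = Some f \<and> (\<forall>i. \<exists>m. stack k g m = prefix_of f i))"
proof -
  obtain c where c: "\<And>g n i. run c g (prod_encode (n, i)) =
      (if \<exists>t. length (stack k g (n + t)) = Suc i then Some (stack_bit k g n i) else None)"
    using stack_bit_code [of k] by blast
  \<comment> \<open>The starting block \<open>n\<close> is built into the program as a constant, as
    in the s-m-n theorem.\<close>
  define prog where "prog n = Comp c (Pair (numeral_code n) (Pair Fst Snd))" for n
  \<comment> \<open>The division counts the complete blocks of the observed string.\<close>
  define F where "F x = goedel (prog (stack_base k (lnth x) (llen x div 3)))" for x
  define \<psi> where "\<psi> \<sigma> = F (list_encode \<sigma>)" for \<sigma>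
  have "recursive (\<lambda>g x. F x)"
    unfolding F_def prog_def goedel.simps
    by (intro recursive_intros recursive_const recursive_goedel_numeral_code recursive_div
        recursive_llen recursive_lnth recursive_subst [OF recursive_stack_base, where H = "\<lambda>g. lnth"]) simp
  then obtain d where d: "\<And>g x. run d g x = Some (F x)"
    unfolding recursive_def by blast
  show ?thesis
  proof (rule that)
    show "learner_index (goedel d) \<psi>" by (simp add: learner_index_def d \<psi>_def)
  next
    fix g N
    assume le: "\<And>j. N \<le> j \<Longrightarrow> kind g j \<le> k" and inf: "infinite {j. kind g j = k}"
    define n where "n = stack_base k g N"
    \<comment> \<open>Blocks between \<open>n\<close> and \<open>N\<close> are covered by the choice
      of \<open>stack_base\<close>, later ones by the assumption on \<open>N\<close>.\<close>
    have le': "kind g j \<le> k" if "n \<le> j" for j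
      using le [of j] kind_le_after_stack_base [of k g N j] that unfolding n_def by (cases "N \<le> j") auto
    have kb0: "stack k g n = []" by (simp add: n_def)
    have "\<psi> (prefix_of g m) = goedel (prog n)" if "3 * N \<le> m" for m
    proof -
      have "stack_base k (lnth (list_encode (prefix_of g m))) (m div 3) = stack_base k g (m div 3)"
        by (rule stack_base_cong) (simp add: lnth_list_encode)
      also have "\<dots> = n" unfolding n_def using that by (intro stack_base_eventually_const le) auto
      finally show ?thesis by (simp add: \<psi>_def F_def)
    qed
    then have "\<forall>\<^sub>F m in sequentially. \<psi> (prefix_of g m) = goedel (prog n)"
      by (auto simp: eventually_sequentially)
    then have lim: "(\<lambda>m. \<psi> (prefix_of g m)) \<longlonglongrightarrow> goedel (prog n)" by (rule tendsto_eventually)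
    have "run (prog n) g i = Some (stack_bit k g n i)" for i
      using ex_length_stack_eq [OF le' kb0 inf, of "Suc i"] by (simp add: prog_def c)
    then have "Phi (goedel (prog n)) g = Some (stack_bit k g n)" by (simp add: Phi_def)
    moreover have "\<exists>m. stack k g m = prefix_of (stack_bit k g n) i" for i
      using ex_length_stack_eq [OF le' kb0 inf, of i] stack_eq_prefix_of_stack_bit [OF le' kb0] by metis
    ultimately show "convergent (\<lambda>n. \<psi> (prefix_of g n)) \<and>
      (\<exists>f. Phi (lim (\<lambda>n. \<psi> (prefix_of g n))) g = Some f \<and> (\<forall>i. \<exists>m. stack k g m = prefix_of f i))"
      using lim by (auto simp: limI convergent_def)
  qed
qed

section \<open>The class Q\<close>

text \<open>Blocks of kind 0 only, carrying the bits of \<open>f\<close>; the test picks out the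
  third place of each block.\<close>

definition embed :: "(nat \<Rightarrow> nat) \<Rightarrow> nat \<Rightarrow> nat" where
  "embed f j = (if j = 3 * (j div 3) + 2 then f (j div 3) else 0)"

definition glue :: "(nat \<Rightarrow> nat) \<Rightarrow> nat \<Rightarrow> (nat \<Rightarrow> nat) \<Rightarrow> nat \<Rightarrow> nat" where
  "glue g n h j = (if j < n then g j else h (j - n))"

lemma embed_simps [simp]: "embed f (3 * j) = 0" "embed f (3 * j + 1) = 0" "embed f (Suc (3 * j)) = 0"
    "embed f (3 * j + 2) = f j" "embed f (Suc (Suc (3 * j))) = f j"
proof -
  have "(3 * j + 1) div 3 = j" "(3 * j + 2) div 3 = j" by auto
  then show "embed f (3 * j) = 0" "embed f (3 * j + 1) = 0" "embed f (3 * j + 2) = f j"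
    by (auto simp: embed_def)
  then show "embed f (Suc (3 * j)) = 0" "embed f (Suc (Suc (3 * j))) = f j" by simp_all
qed

lemma kind_embed [simp]: "kind (embed f) j = 0" and letter_embed [simp]: "letter (embed f) j = f j"
  by (simp_all add: kind_def letter_def)

lemma kind_glue: "kind (glue g (3 * m) h) (m + j) = kind h j"
  and letter_glue: "letter (glue g (3 * m) h) (m + j) = letter h j"
  by (simp_all add: kind_def letter_def glue_def algebra_simps)

lemma embed_code: obtains c where "\<And>f j. run c f j = Some (embed f j)"
proof -
  have "recursive embed"
    unfolding embed_def
    by (intro recursive_intros recursive_const recursive_div) simp_all
  then show ?thesis using that unfolding recursive_def by blast
qed

text \<open>The value 1 of \<open>bounded_run\<close> means output 0, that is, a refutation of
  membership found within the bound \<open>L\<close>.\<close>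

definition tree :: "code \<Rightarrow> (nat \<Rightarrow> nat) \<Rightarrow> nat \<Rightarrow> bool" where
  "tree c g L \<longleftrightarrow> (\<forall>n<L. g n \<le> 1 \<and> bounded_run c g L n \<noteq> 1)"

text \<open>Soundness of bounded evaluation shows that members are never refuted, completeness that
  non-members are refuted at some level.\<close>

lemma mem_Pi01_iff_tree:
  assumes c: "\<And>g n. run c g n = Some (if R n g then 1 else 0)"
    and P: "P = {g. \<forall>n. R n g}" "P \<subseteq> cantor"
  shows "f \<in> P \<longleftrightarrow> (\<forall>L. tree c f L)"
proof
  assume f: "f \<in> P"
  have "bounded_run c f L n \<noteq> 1" for L n
    using bounded_run_sound [of c f L n 0] c [of f n] f P(1) by auto
  moreover have "f n \<le> 1" for n using f P(2) by (auto simp: cantor_def image_subset_iff le_Suc_eq)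
  ultimately show "\<forall>L. tree c f L" by (simp add: tree_def)
next
  assume t: "\<forall>L. tree c f L"
  have "R n f" for n
  proof (rule ccontr)
    assume "\<not> R n f"
    then have "\<forall>\<^sub>F L in sequentially. bounded_run c f L n = Suc 0"
      using c [of f n] by (intro bounded_run_complete) simp
    \<comment> \<open>Level \<open>L\<close> only tests arguments below \<open>L\<close>, so
      \<open>L\<close> must also exceed \<open>n\<close>.\<close>
    with eventually_gt_at_top [of n] have "\<forall>\<^sub>F L in sequentially. n < L \<and> bounded_run c f L n = Suc 0"
      by (rule eventually_conj)
    then obtain L where "n < L" "bounded_run c f L n = Suc 0"
      by (auto simp: eventually_sequentially)
    with t show False by (auto simp: tree_def)
  qed
  then show "f \<in> P" by (simp add: P(1))
qed

lemma tree_cong: "(\<And>i. i < L \<Longrightarrow> g i = h i) \<Longrightarrow> tree c g L = tree c h L"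
  using bounded_run_cong [of L g h c] by (auto simp: tree_def)

lemma recursive_bounded_run:
  assumes "recursive A" "recursive B"
  shows "recursive (\<lambda>g x. bounded_run c g (A g x) (B g x))"
  using recursive_compose [OF recursive_bounded_run_aux [of c] recursive_pair [OF assms]] by simp

lemma decidable_tree: "decidable (tree c)"
  unfolding tree_def by (intro recursive_intros recursive_const recursive_bounded_run)

lemma recursive_subst_lnth:
  assumes "recursive F" "recursive W" "recursive N"
  shows "recursive (\<lambda>g x. F (lnth (W g x)) (N g x))"
  by (rule recursive_subst [OF assms(1) _ assms(3), where H = "\<lambda>g x. lnth (W g x)"])
    (intro recursive_lnth recursive_compose [OF assms(2)] recursive_intros)

lemma ex_lnth: "\<exists>w. \<forall>i<n. lnth w i = g i"
  by (rule exI [of _ "list_encode (prefix_of g n)"]) (simp add: lnth_list_encode)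

text \<open>If the top value occurs only finitely often, the bound drops by one after its last
  occurrence.\<close>

lemma ex_largest_frequent_value:
  fixes f :: "nat \<Rightarrow> nat"
  assumes "\<And>j. N \<le> j \<Longrightarrow> f j \<le> K"
  shows "\<exists>k\<le>K. infinite {j. f j = k} \<and> (\<exists>N. \<forall>j\<ge>N. f j \<le> k)"
  using assms
proof (induction K arbitrary: N)
  case 0
  then have "{N..} \<subseteq> {j. f j = 0}" by auto
  then have "infinite {j. f j = 0}" by (metis finite_subset infinite_Ici)
  with 0 show ?case by auto
next
  case (Suc K)
  show ?case
  proof (cases "finite {j. f j = Suc K}")
    case True
    then obtain M where "\<And>j. f j = Suc K \<Longrightarrow> j < M"
      unfolding finite_nat_set_iff_bounded by auto
    then have "f j \<le> K" if "max M N \<le> j" for j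
      using Suc.prems [of j] that by (metis le_Suc_eq max.bounded_iff not_less)
    from Suc.IH [OF this] show ?thesis by (meson le_SucI)
  qed (use Suc.prems in auto)
qed

section \<open>Obtaining reductions\<close>

lemma one_omega_imp_fin_omega: "one_omega_computable \<Gamma> \<Longrightarrow> fin_omega_computable \<Gamma>"
  unfolding one_omega_computable_def fin_omega_computable_def learner_def by (meson lessI)

lemma le_one_omega_imp_le_fin_omega: "le_one_omega A B \<Longrightarrow> le_fin_omega A B"
  unfolding le_one_omega_def le_fin_omega_def reducible_by_def
  using one_omega_imp_fin_omega by blast

text \<open>A single program is identified by the learner that always guesses its index.\<close>

lemma le_one_omegaI:
  assumes "\<And>g. g \<in> B \<Longrightarrow> \<exists>f\<in>A. \<forall>n. run c g n = Some (f n)"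
  shows "le_one_omega A B"
proof -
  define \<Gamma> where "\<Gamma> = Phi (goedel c)"
  have "learner (\<lambda>_. goedel c)"
    unfolding learner_def learner_index_def
    by (rule exI [of _ "goedel (numeral_code (goedel c))"]) simp
  then have "one_omega_computable \<Gamma>"
    unfolding one_omega_computable_def identifies_def \<Gamma>_def
    by (intro exI [of _ "\<lambda>_. goedel c"]) (simp add: convergent_const)
  moreover have "\<exists>f\<in>A. \<Gamma> g = Some f" if g: "g \<in> B" for g
  proof -
    from assms [OF g] obtain f where "f \<in> A" "\<forall>n. run c g n = Some (f n)" by blast
    then show ?thesis by (intro bexI [of _ f]) (simp_all add: \<Gamma>_def Phi_def)
  qed
  ultimately show ?thesis
    unfolding le_one_omega_def reducible_by_def by (intro exI [of _ \<Gamma>]) fastforce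
qed

text \<open>By the first assumption \<open>T g L\<close> speaks only of the string of the first
  \<open>L\<close> entries of \<open>g\<close>; so \<open>T\<close> acts as a computable binary tree
  with \<open>P\<close> as its set of paths.\<close>

locale special_class =
  fixes P :: "(nat \<Rightarrow> nat) set" and T :: "(nat \<Rightarrow> nat) \<Rightarrow> nat \<Rightarrow> bool"
  assumes T_cong: "(\<And>i. i < L \<Longrightarrow> g i = h i) \<Longrightarrow> T g L = T h L"
    and decidable_T: "decidable T"
    and T_binary: "T g L \<Longrightarrow> i < L \<Longrightarrow> g i \<le> 1"
    and mem_P_iff: "f \<in> P \<longleftrightarrow> (\<forall>L. T f L)"
    and special_P: "special P"
begin

definition in_tree :: "nat list \<Rightarrow> bool" where
  "in_tree l \<longleftrightarrow> T (lnth (list_encode l)) (length l)"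

lemma in_tree_prefix_of: "in_tree (prefix_of f n) \<longleftrightarrow> T f n"
  unfolding in_tree_def by (simp, rule T_cong) (simp add: lnth_list_encode)

lemma P_binary: "f \<in> P \<Longrightarrow> f i \<le> 1"
  using T_binary [of f "Suc i" i] by (simp add: mem_P_iff)

lemma decidable_in_tree_stack:
  assumes "recursive A"
  shows "decidable (\<lambda>g x. in_tree (stack k g (A g x)))"
proof -
  define r where "r = (\<lambda>g x. list_encode (rev (stack k g x)))"
  have r: "recursive r" unfolding r_def by (intro recursive_stack recursive_intros)
  have r1: "recursive (\<lambda>g z. r g (proj1 z))"
    by (intro recursive_compose [OF r] recursive_intros)
  \<comment> \<open>The stack is available as a reversed code, so the oracle given to
    \<open>T\<close> reads it from the back.\<close>
  have "decidable (\<lambda>g x. T (\<lambda>i. lnth (r g x) (llen (r g x) - 1 - i)) (llen (r g x)))"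
    by (rule recursive_subst [OF decidable_T, where H = "\<lambda>g x i. lnth (r g x) (llen (r g x) - 1 - i)"])
      (intro recursive_lnth recursive_llen recursive_intros recursive_const r r1)+
  moreover have "T (\<lambda>i. lnth (r g x) (llen (r g x) - 1 - i)) (llen (r g x)) = in_tree (stack k g x)" for g x
    unfolding in_tree_def r_def
    by (simp, rule T_cong) (simp add: lnth_list_encode rev_nth)
  ultimately have "decidable (\<lambda>g x. in_tree (stack k g x))" by simp
  from recursive_compose [OF this assms] show ?thesis .
qed

text \<open>The index \<open>m\<close> counts single entries in the first conjunct and blocks in the
  others; sharing it yields the form required by \<open>Pi01\<close> at once.\<close>

definition Q :: "(nat \<Rightarrow> nat) set" where
  "Q = {g. \<forall>m. g m \<le> 1 \<and> in_tree (stack 0 g m) \<and> in_tree (stack 1 g m) \<and> in_tree (stack 2 g m)}"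

lemma Q_subset_cantor: "Q \<subseteq> cantor"
  by (auto simp: Q_def cantor_def image_subset_iff le_Suc_eq)

lemma Pi01_Q: "Pi01 Q"
proof -
  have "decidable (\<lambda>g m. g m \<le> 1 \<and> in_tree (stack 0 g m) \<and> in_tree (stack 1 g m) \<and> in_tree (stack 2 g m))"
    by (intro recursive_intros recursive_const decidable_in_tree_stack)
  then have "computable_rel (\<lambda>m g. g m \<le> 1 \<and> in_tree (stack 0 g m) \<and> in_tree (stack 1 g m) \<and> in_tree (stack 2 g m))"
    unfolding recursive_def computable_rel_def of_bool_def .
  then show ?thesis unfolding Pi01_def Q_def by blast
qed

section \<open>Extendible strings and the closed subclass\<close>

definition extendible :: "nat list \<Rightarrow> bool" where
  "extendible l \<longleftrightarrow> (\<exists>f\<in>P. l = prefix_of f (length l))"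

lemma ex_mem_P: "\<exists>f. f \<in> P"
  using special_P by (auto simp: special_def)

lemma extendible_Nil [simp]: "extendible []"
  using ex_mem_P by (auto simp: extendible_def prefix_of_def)

lemma extendible_prefix_of: "f \<in> P \<Longrightarrow> extendible (prefix_of f n)"
  by (auto simp: extendible_def)

lemma extendible_imp_in_tree: "extendible l \<Longrightarrow> in_tree l"
  unfolding extendible_def using in_tree_prefix_of mem_P_iff by metis

lemma extendible_snoc:
  assumes "extendible l" obtains b where "b \<le> 1" "extendible (l @ [b])"
proof -
  from assms obtain f where f: "f \<in> P" "l = prefix_of f (length l)" by (auto simp: extendible_def)
  then have "extendible (l @ [f (length l)])" by (metis extendible_prefix_of prefix_of_Suc)
  with P_binary [OF f(1)] show ?thesis by (rule that)
qed

text \<open>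
  Unlike in \<open>Q\<close>, the stacks of kind \<open>1\<close> and \<open>2\<close> have to be extendible in \<open>P\<close>. This condition is not
  effective, but it makes every good string an initial segment of a member of \<open>Qplus\<close>.
\<close>

definition good :: "(nat \<Rightarrow> nat) \<Rightarrow> nat \<Rightarrow> bool" where
  "good g m \<longleftrightarrow> (\<forall>j<3 * m. g j \<le> 1) \<and>
     (\<forall>i\<le>m. extendible (stack 2 g i) \<and> extendible (stack 1 g i) \<and> in_tree (stack 0 g i))"

text \<open>A closed set, since \<open>good g m\<close> depends on a finite string; the category
  argument takes place in it.\<close>

definition Qplus :: "(nat \<Rightarrow> nat) set" where
  "Qplus = {g. \<forall>m. good g m}"

lemma good_cong:
  assumes "\<And>i. i < 3 * m \<Longrightarrow> g i = h i" shows "good g m = good h m"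
proof -
  have "stack k g i = stack k h i" if "i \<le> m" for k i
    using that by (intro stack_cong assms) auto
  with assms show ?thesis by (simp add: good_def)
qed

lemma good_0: "good g 0"
  by (simp add: good_def extendible_imp_in_tree)

lemma good_Suc:
  "good g (Suc m) \<longleftrightarrow> good g m \<and> g (3 * m) \<le> 1 \<and> g (3 * m + 1) \<le> 1 \<and> g (3 * m + 2) \<le> 1 \<and>
     extendible (stack 2 g (Suc m)) \<and> extendible (stack 1 g (Suc m)) \<and> in_tree (stack 0 g (Suc m))"
proof -
  have le: "(\<forall>i\<le>Suc m. R i) \<longleftrightarrow> (\<forall>i\<le>m. R i) \<and> R (Suc m)" for R
    by (auto simp: le_Suc_eq)
  have less: "(\<forall>j<3 * Suc m. g j \<le> 1) \<longleftrightarrow>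
      (\<forall>j<3 * m. g j \<le> 1) \<and> g (3 * m) \<le> 1 \<and> g (3 * m + 1) \<le> 1 \<and> g (3 * m + 2) \<le> 1"
  proof -
    have "3 * Suc m = Suc (Suc (Suc (3 * m)))" by simp
    then show ?thesis by (simp only: All_less_Suc) auto
  qed
  show ?thesis by (simp only: good_def le less conj_ac)
qed

lemma good_le: "good g m \<Longrightarrow> n \<le> m \<Longrightarrow> good g n"
  by (auto simp: good_def)

lemma Qplus_subset_Q: "Qplus \<subseteq> Q"
proof
  fix g assume "g \<in> Qplus"
  then have g: "good g m" for m by (simp add: Qplus_def)
  have "g m \<le> 1" for m using g [of "Suc m"] by (simp add: good_def)
  moreover have "in_tree (stack 0 g m) \<and> in_tree (stack 1 g m) \<and> in_tree (stack 2 g m)" for m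
    using g [of m] extendible_imp_in_tree unfolding good_def by blast
  ultimately show "g \<in> Q" by (simp add: Q_def)
qed

text \<open>The added blocks have kind 0: they build initial segments of \<open>f\<close> on the
  empty stack of kind 0 and leave the other stacks alone.\<close>

lemma glue_embed_mem_Qplus:
  assumes g: "good g m" "stack 0 g m = []" and f: "f \<in> P"
  shows "glue g (3 * m) (embed f) \<in> Qplus"
proof -
  let ?h = "glue g (3 * m) (embed f)"
  have hg: "stack k ?h m = stack k g m" for k by (rule stack_cong) (simp add: glue_def)
  have kind: "kind ?h (m + t) = 0" and letter: "letter ?h (m + t) = f t" for t
    by (simp_all add: kind_glue letter_glue)
  have stack: "stack 0 ?h (m + t) = prefix_of f t" "0 < k \<Longrightarrow> stack k ?h (m + t) = stack k g m" for k t
    by (induction t) (simp_all add: kind letter hg g(2) prefix_of_Suc, simp add: prefix_of_def)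
  have bin: "?h (3 * m + 3 * t) \<le> 1" "?h (3 * m + 3 * t + 1) \<le> 1" "?h (3 * m + 3 * t + 2) \<le> 1" for t
    using P_binary [OF f] by (simp_all add: glue_def)
  have "good ?h (m + t)" for t
  proof (induction t)
    case 0
    have "good ?h m = good g m" by (rule good_cong) (simp add: glue_def)
    with g(1) show ?case by simp
  next
    case (Suc t)
    have "extendible (stack 2 g m)" "extendible (stack 1 g m)" using g(1) by (auto simp: good_def)
    with Suc bin [of t] extendible_imp_in_tree [OF extendible_prefix_of [OF f, of "Suc t"]] stack(1) [of "Suc t"] stack(2) [of 1 "Suc t"] stack(2) [of 2 "Suc t"]
    show ?case by (simp add: good_Suc distrib_left del: stack.simps)
  qed
  then have "good ?h i" for i by (rule good_le [of _ "m + i"]) simp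
  then show ?thesis unfolding Qplus_def by blast
qed

text \<open>The kind is \<open>1 + (k - 1)\<close>, which is \<open>k\<close> for positive
  \<open>k\<close>. Only the first three entries serve as the block.\<close>

definition block :: "nat \<Rightarrow> nat \<Rightarrow> nat \<Rightarrow> nat" where
  "block k b j = (if j = 0 then 1 else if j = 1 then k - 1 else b)"

text \<open>Smaller stacks become empty, hence extendible, and larger ones do not change. The stack
  of kind 0 is empty afterwards, as needed for continuing with \<open>embed\<close>.\<close>

lemma good_glue_block:
  assumes g: "good g m" and k: "k = 1 \<or> k = 2" and b: "b \<le> 1" "extendible (stack k g m @ [b])"
  defines "h \<equiv> glue g (3 * m) (block k b)"
  shows "good h (Suc m)" "\<And>i. i < k \<Longrightarrow> stack i h (Suc m) = []"
proof -
  have hg: "stack i h m = stack i g m" for i by (rule stack_cong) (simp add: glue_def h_def)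
  have kind: "kind h m = k" using k kind_glue [of g m _ 0] by (auto simp: h_def kind_def block_def)
  have letter: "letter h m = b" using letter_glue [of g m _ 0] by (auto simp: h_def letter_def block_def)
  show "stack i h (Suc m) = []" if "i < k" for i
    using that by (simp add: kind)
  have "good h m = good g m" by (rule good_cong) (simp add: glue_def h_def)
  moreover have "h (3 * m) \<le> 1" "h (3 * m + 1) \<le> 1" "h (3 * m + 2) \<le> 1"
    using k b by (auto simp: h_def glue_def block_def)
  moreover have "extendible (stack 2 h (Suc m)) \<and> extendible (stack 1 h (Suc m)) \<and> in_tree (stack 0 h (Suc m))"
    using k b g extendible_imp_in_tree [OF extendible_Nil] by (auto simp: hg kind letter good_def)
  ultimately show "good h (Suc m)" using g by (simp add: good_Suc)
qed

text \<open>Baire category: otherwise any member of \<open>Qplus\<close> can be replaced by one that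
  keeps a given initial segment and later shows another guess. Iteration yields a limit in the
  closed set \<open>Qplus\<close> on which the guesses do not converge.\<close>

lemma ex_constant_learner:
  assumes conv: "\<And>g. g \<in> Qplus \<Longrightarrow> convergent (\<lambda>n. \<psi> (prefix_of g n) :: nat)"
  obtains g0 n0 where "g0 \<in> Qplus"
    "\<And>g n. g \<in> Qplus \<Longrightarrow> (\<And>i. i < n0 \<Longrightarrow> g i = g0 i) \<Longrightarrow> n0 \<le> n \<Longrightarrow>
       \<psi> (prefix_of g n) = \<psi> (prefix_of g0 n0)"
proof (rule ccontr)
  assume neg: "\<not> thesis"
  note settled = that
  \<comment> \<open>A pair holds a sequence and the length of its frozen initial segment.\<close>
  let ?R = "\<lambda>x y. (\<forall>i<snd x. fst y i = fst x i) \<and> snd x < snd y \<and>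
    \<psi> (prefix_of (fst y) (snd y)) \<noteq> \<psi> (prefix_of (fst x) (snd x))"
  have step: "\<exists>y. fst y \<in> Qplus \<and> ?R x y" if x: "fst x \<in> Qplus" for x :: "(nat \<Rightarrow> nat) \<times> nat"
  proof -
    have "\<exists>g n. g \<in> Qplus \<and> (\<forall>i<snd x. g i = fst x i) \<and> snd x \<le> n \<and>
      \<psi> (prefix_of g n) \<noteq> \<psi> (prefix_of (fst x) (snd x))"
    proof (rule ccontr)
      assume *: "\<not> ?thesis"
      have thesis by (rule settled [OF x, of "snd x"]) (use * in blast)
      with neg show False ..
    qed
    then obtain g n where g: "g \<in> Qplus" "\<And>i. i < snd x \<Longrightarrow> g i = fst x i" "snd x \<le> n"
      "\<psi> (prefix_of g n) \<noteq> \<psi> (prefix_of (fst x) (snd x))"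
      by blast
    have "prefix_of g (snd x) = prefix_of (fst x) (snd x)" using g(2) by (simp add: prefix_of_def)
    with g(3,4) have "snd x < n" by (cases "n = snd x") auto
    with g show ?thesis by (intro exI [of _ "(g, n)"]) auto
  qed
  have init: "\<exists>x :: (nat \<Rightarrow> nat) \<times> nat. fst x \<in> Qplus"
  proof -
    from ex_mem_P obtain f where "f \<in> P" ..
    then have "glue f (3 * 0) (embed f) \<in> Qplus" by (intro glue_embed_mem_Qplus good_0) simp_all
    then show ?thesis by auto
  qed
  have "\<exists>S. \<forall>i. fst (S i) \<in> Qplus \<and> ?R (S i) (S (Suc i))"
    by (rule dependent_nat_choice [OF init step])
  then obtain S where S: "\<And>i. fst (S i) \<in> Qplus" "\<And>i. ?R (S i) (S (Suc i))" by blast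
  define G N where "G i = fst (S i)" and "N i = snd (S i)" for i
  have G: "G i \<in> Qplus" and agree: "j < N i \<Longrightarrow> G (Suc i) j = G i j" and N: "N i < N (Suc i)"
    and ne: "\<psi> (prefix_of (G (Suc i)) (N (Suc i))) \<noteq> \<psi> (prefix_of (G i) (N i))" for i j
    using S [of i] by (simp_all add: G_def N_def)
  have mono: "strict_mono N" using N by (simp add: strict_mono_Suc_iff)
  have agree': "G k j = G i j" if "i \<le> k" "j < N i" for i j k
    using that(1)
  proof (induction k rule: dec_induct)
    case (step k)
    have "N i \<le> N k" using mono step by (simp add: strict_mono_less_eq)
    with step agree [of j k] that(2) show ?case by simp
  qed simp
  \<comment> \<open>Stage \<open>j + 1\<close> has frozen entry \<open>j\<close>, because
    \<open>N\<close> increases strictly.\<close>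
  define g where "g j = G (Suc j) j" for j
  have g: "g j = G i j" if "j < N i" for i j
  proof (cases "i \<le> Suc j")
    case False
    have "j < N (Suc j)" using strict_mono_imp_increasing [OF mono, of "Suc j"] by simp
    with False show ?thesis using agree' [of "Suc j" i j] by (simp add: g_def)
  qed (use agree' that in \<open>simp add: g_def\<close>)
  have "good g m" for m
  proof -
    have "3 * m \<le> N (3 * m)" using strict_mono_imp_increasing [OF mono] .
    then have "good g m = good (G (3 * m)) m" by (intro good_cong g) simp
    with G show ?thesis by (simp add: Qplus_def)
  qed
  then have "convergent (\<lambda>n. \<psi> (prefix_of g n))" by (intro conv) (auto simp: Qplus_def)
  then obtain e where "\<forall>\<^sub>F n in sequentially. \<psi> (prefix_of g n) = e"
    unfolding convergent_def tendsto_discrete by blast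
  then obtain M where M: "\<And>n. M \<le> n \<Longrightarrow> \<psi> (prefix_of g n) = e"
    by (auto simp: eventually_sequentially)
  have "prefix_of g (N i) = prefix_of (G i) (N i)" for i
    by (simp add: prefix_of_def g)
  moreover have "M \<le> N M" "M \<le> N (Suc M)"
    using strict_mono_imp_increasing [OF mono, of M] strict_mono_imp_increasing [OF mono, of "Suc M"] by auto
  ultimately show False using M ne [of M] by metis
qed

text \<open>Kinds are at most 2 on \<open>Q\<close>, so one of three learners knows the largest kind
  occurring infinitely often. Its final stack has all initial segments in the tree and thus lies in
  \<open>P\<close>.\<close>

lemma le_fin_omega_P_Q: "le_fin_omega P Q"
proof -
  have "\<exists>e \<psi>. learner_index e \<psi> \<and> (\<forall>g. infinite {j. kind g j = k} \<and> (\<exists>N. \<forall>j\<ge>N. kind g j \<le> k) \<longrightarrow>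
      convergent (\<lambda>n. \<psi> (prefix_of g n)) \<and>
      (\<exists>f. Phi (lim (\<lambda>n. \<psi> (prefix_of g n))) g = Some f \<and> (\<forall>i. \<exists>m. stack k g m = prefix_of f i)))" for k
    using identifying_learner [of k] by metis
  then obtain e \<psi> where idx: "\<And>k. learner_index (e k) (\<psi> k)" and
    id: "\<And>k g. infinite {j. kind g j = k} \<Longrightarrow> \<exists>N. \<forall>j\<ge>N. kind g j \<le> k \<Longrightarrow>
      convergent (\<lambda>n. \<psi> k (prefix_of g n)) \<and>
      (\<exists>f. Phi (lim (\<lambda>n. \<psi> k (prefix_of g n))) g = Some f \<and> (\<forall>i. \<exists>m. stack k g m = prefix_of f i))"
    by metis
  have "\<exists>k\<le>2. convergent (\<lambda>n. \<psi> k (prefix_of g n)) \<and>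
      (\<exists>f\<in>P. Phi (lim (\<lambda>n. \<psi> k (prefix_of g n))) g = Some f)" if g: "g \<in> Q" for g
  proof -
    have "g i \<le> 1" for i using g by (simp add: Q_def)
    then have "kind g j \<le> 2" for j unfolding kind_def by (metis add_mono one_add_one)
    then obtain k where k: "k \<le> 2" "infinite {j. kind g j = k}" "\<exists>N. \<forall>j\<ge>N. kind g j \<le> k"
      using ex_largest_frequent_value [of 0 "kind g" 2] by auto
    from id [OF k(2,3)] obtain f where f: "convergent (\<lambda>n. \<psi> k (prefix_of g n))"
      "Phi (lim (\<lambda>n. \<psi> k (prefix_of g n))) g = Some f" "\<And>i. \<exists>m. stack k g m = prefix_of f i"
      by blast
    have "in_tree (stack k g m)" for m
      using g k(1) by (auto simp: Q_def le_Suc_eq numeral_2_eq_2)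
    then have "T f i" for i using f(3) in_tree_prefix_of by metis
    then have "f \<in> P" by (simp add: mem_P_iff)
    with k(1) f(1,2) show ?thesis by blast
  qed
  \<comment> \<open>The right kind is chosen non-effectively for each \<open>g\<close>; only the
    bound on the learner indices has to be uniform.\<close>
  then obtain \<kappa> where \<kappa>: "\<And>g. g \<in> Q \<Longrightarrow> \<kappa> g \<le> 2"
    "\<And>g. g \<in> Q \<Longrightarrow> convergent (\<lambda>n. \<psi> (\<kappa> g) (prefix_of g n))"
    "\<And>g. g \<in> Q \<Longrightarrow> \<exists>f\<in>P. Phi (lim (\<lambda>n. \<psi> (\<kappa> g) (prefix_of g n))) g = Some f"
    by metis
  define \<Gamma> where "\<Gamma> g = (if g \<in> Q then Phi (lim (\<lambda>n. \<psi> (\<kappa> g) (prefix_of g n))) g else None)" for g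
  have "fin_omega_computable \<Gamma>"
    unfolding fin_omega_computable_def
  proof (rule exI [of _ "Suc (Max (e ` {..2}))"], rule ballI)
    fix g assume "g \<in> dom \<Gamma>"
    then have g: "g \<in> Q" by (auto simp: \<Gamma>_def split: if_splits)
    have "e (\<kappa> g) < Suc (Max (e ` {..2}))" using \<kappa>(1) [OF g] by (simp add: less_Suc_eq_le)
    moreover have "identifies (\<psi> (\<kappa> g)) \<Gamma> g"
      using \<kappa>(2) [OF g] g by (simp add: identifies_def \<Gamma>_def)
    ultimately show "\<exists>i<Suc (Max (e ` {..2})). \<exists>\<psi>. learner_index i \<psi> \<and> identifies \<psi> \<Gamma> g"
      using idx by blast
  qed
  moreover have "\<exists>f\<in>P. \<Gamma> g = Some f" if "g \<in> Q" for g
    using \<kappa>(3) [OF that] that by (simp add: \<Gamma>_def)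
  ultimately show ?thesis
    unfolding le_fin_omega_def reducible_by_def by (intro exI [of _ \<Gamma>]) fastforce
qed

text \<open>In \<open>embed f\<close> the stack of kind 0 runs through the initial segments of
  \<open>f\<close>, and the other stacks stay empty.\<close>

lemma le_one_omega_Q_P: "le_one_omega Q P"
proof -
  obtain c where c: "\<And>f j. run c f j = Some (embed f j)" using embed_code by blast
  have "embed f \<in> Q" if "f \<in> P" for f
  proof -
    have "glue f (3 * 0) (embed f) \<in> Qplus" using that by (intro glue_embed_mem_Qplus good_0) simp_all
    moreover have "glue f (3 * 0) (embed f) = embed f" by (simp add: glue_def fun_eq_iff)
    ultimately show ?thesis using Qplus_subset_Q by auto
  qed
  with c show ?thesis by (intro le_one_omegaI [of _ _ c]) auto
qed

section \<open>The diagonal argument\<close>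

text \<open>
  A state \<open>(p, w)\<close> of the construction is the string of the first \<open>Suc p\<close> blocks of the sequence
  coded by \<open>w\<close>; its last block has nonzero kind.
\<close>

definition next_state :: "code \<Rightarrow> nat \<Rightarrow> nat \<Rightarrow> nat \<Rightarrow> nat \<Rightarrow> nat \<Rightarrow> bool" where
  "next_state c i p w p' w' \<longleftrightarrow>
     p < p' \<and> (\<forall>j<3 * Suc p. lnth w' j = lnth w j) \<and> (\<forall>j<3 * Suc p'. lnth w' j \<le> 1) \<and>
     (\<forall>j<p'. p < j \<longrightarrow> kind (lnth w') j = 0) \<and> kind (lnth w') p' = 1 \<and>
     (\<forall>j<Suc p'. in_tree (stack 0 (lnth w') j)) \<and>
     bounded_run c (lnth w') (3 * p') i = Suc (letter (lnth w') p')"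

text \<open>The stack of kind 1 consists of the first \<open>i\<close> outputs of \<open>c\<close>.
  Each is computed with queries inside the string (\<open>L \<le> 3 * Suc p\<close>), so it persists
  under extension. The empty stack of kind 0 keeps the string extendible within
  \<open>Qplus\<close>.\<close>

definition state_inv :: "code \<Rightarrow> (nat \<Rightarrow> nat) \<Rightarrow> nat \<Rightarrow> nat \<Rightarrow> nat \<Rightarrow> nat \<Rightarrow> bool" where
  "state_inv c g0 n0 i p w \<longleftrightarrow>
     good (lnth w) (Suc p) \<and> n0 \<le> 3 * Suc p \<and> (\<forall>j<n0. lnth w j = g0 j) \<and>
     stack 0 (lnth w) (Suc p) = [] \<and> length (stack 1 (lnth w) (Suc p)) = i \<and>
     (\<forall>j<i. \<exists>L\<le>3 * Suc p. bounded_run c (lnth w) L j = Suc (stack 1 (lnth w) (Suc p) ! j))"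

text \<open>\<open>next_state\<close> asks for membership in the tree, not for extendibility, so it
  is decidable, and a search over coded pairs finds a successor whenever one exists.\<close>

lemma next_state_code:
  obtains d where "\<And>g p w i. \<exists>p' w'. next_state c i p w p' w' \<Longrightarrow>
    \<exists>p' w'. run d g (prod_encode (prod_encode (p, w), i)) = Some (prod_encode (p', w')) \<and>
      next_state c i p w p' w'"
proof -
  have *: "decidable (\<lambda>g z. next_state c (proj2 (proj1 z)) (proj1 (proj1 (proj1 z))) (proj2 (proj1 (proj1 z))) (proj1 (proj2 z)) (proj2 (proj2 z)))"
    unfolding next_state_def kind_def letter_def
    by (intro recursive_intros recursive_const recursive_lnth
        recursive_subst_lnth [where F = "\<lambda>g x. of_bool (in_tree (stack 0 g x))"] decidable_in_tree_stack
        recursive_subst_lnth [where F = "\<lambda>g x. bounded_run c g (proj1 x) (proj2 x)"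
          and N = "\<lambda>g z. prod_encode (3 * proj1 (proj2 z), proj2 (proj1 z))", simplified] recursive_bounded_run_aux)
  from mu_code [OF *] obtain d where d: "\<And>g x. run d g x =
      (if \<exists>n. next_state c (proj2 x) (proj1 (proj1 x)) (proj2 (proj1 x)) (proj1 n) (proj2 n)
       then Some (LEAST n. next_state c (proj2 x) (proj1 (proj1 x)) (proj2 (proj1 x)) (proj1 n) (proj2 n)) else None)"
    by blast
  show ?thesis
  proof (rule that)
    fix g p w i
    assume "\<exists>p' w'. next_state c i p w p' w'"
    then have ex: "\<exists>n. next_state c i p w (proj1 n) (proj2 n)" by (metis proj1_pair proj2_pair)
    define n where "n = (LEAST n. next_state c i p w (proj1 n) (proj2 n))"
    have "next_state c i p w (proj1 n) (proj2 n)" using LeastI_ex [OF ex] by (simp add: n_def)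
    moreover have "run d g (prod_encode (prod_encode (p, w), i)) = Some n" using ex by (simp add: d n_def)
    ultimately show "\<exists>p' w'. run d g (prod_encode (prod_encode (p, w), i)) = Some (prod_encode (p', w')) \<and>
      next_state c i p w p' w'"
      by (metis pair_proj)
  qed
qed

context
  fixes c :: code and g0 :: "nat \<Rightarrow> nat" and n0 :: nat
  assumes c: "\<And>g. g \<in> Qplus \<Longrightarrow> (\<And>i. i < n0 \<Longrightarrow> g i = g0 i) \<Longrightarrow> \<exists>f\<in>P. \<forall>n. run c g n = Some (f n)"
begin

text \<open>Continuing with a member of \<open>P\<close> in blocks of kind 0 gives a member of
  \<open>Qplus\<close>, on which \<open>c\<close> must output some \<open>f i\<close>. Once this
  computation is visible, a block of kind 1 with that bit is placed.\<close>

lemma ex_next_state: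
  assumes inv: "state_inv c g0 n0 i p w"
  shows "\<exists>p' w'. next_state c i p w p' w'"
proof -
  obtain f0 where f0: "f0 \<in> P" using ex_mem_P ..
  define h where "h = glue (lnth w) (3 * Suc p) (embed f0)"
  have h: "h \<in> Qplus"
    unfolding h_def using inv f0 by (intro glue_embed_mem_Qplus) (auto simp: state_inv_def)
  moreover have "h j = g0 j" if "j < n0" for j
    using inv that by (auto simp: h_def glue_def state_inv_def)
  ultimately obtain f where f: "f \<in> P" "run c h i = Some (f i)" using c by blast
  have "\<forall>\<^sub>F L in sequentially. bounded_run c h L i = Suc (f i)" using f(2) by (rule bounded_run_complete)
  then obtain L where L: "\<And>n. L \<le> n \<Longrightarrow> bounded_run c h n i = Suc (f i)"
    by (auto simp: eventually_sequentially)
  \<comment> \<open>Then \<open>3 * p'\<close> exceeds \<open>L\<close>, so the computation ends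
    within the entries before block \<open>p'\<close>.\<close>
  define p' where "p' = Suc (p + L)"
  obtain w' where w': "\<And>j. j < 3 * Suc p' \<Longrightarrow> lnth w' j = glue h (3 * p') (block 1 (f i)) j"
    using ex_lnth by blast
  have w'h: "lnth w' j = h j" if "j < 3 * p'" for j using w' [of j] that by (simp add: glue_def)
  have "kind (lnth w') p' = 1" "letter (lnth w') p' = f i"
    using w' [of "3 * p'"] w' [of "3 * p' + 1"] w' [of "3 * p' + 2"]
    by (simp_all add: kind_def letter_def glue_def block_def)
  moreover have "bounded_run c (lnth w') (3 * p') i = Suc (f i)"
    using bounded_run_cong [of "3 * p'" "lnth w'" h c i] w'h L [of "3 * p'"] by (simp add: p'_def)
  moreover have "kind (lnth w') j = 0" if "p < j" "j < p'" for j
  proof -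
    have "kind (lnth w') j = kind h j" by (rule kind_cong [of p']) (use w'h that in auto)
    also have "\<dots> = 0" using kind_glue [of "lnth w" "Suc p" "embed f0" "j - Suc p"] that by (simp add: h_def)
    finally show ?thesis .
  qed
  moreover have "lnth w' j \<le> 1" if "j < 3 * Suc p'" for j
  proof -
    have "h j \<le> 1" using Qplus_subset_Q h by (auto simp: Q_def)
    with w' [OF that] P_binary [OF f(1), of i] show ?thesis by (simp add: glue_def block_def)
  qed
  moreover have "in_tree (stack 0 (lnth w') j)" if "j < Suc p'" for j
  proof -
    have "stack 0 (lnth w') j = stack 0 h j" using that by (intro stack_cong w'h) simp
    moreover have "good h j" using h by (simp add: Qplus_def)
    ultimately show ?thesis by (simp add: good_def)
  qed
  moreover have "lnth w' j = lnth w j" if "j < 3 * Suc p" for j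
    using w'h [of j] that by (simp add: h_def p'_def glue_def)
  moreover have "p < p'" by (simp add: p'_def)
  ultimately show ?thesis unfolding next_state_def by metis
qed

text \<open>This must hold for whatever successor the search finds, whose blocks of kind 0 need not
  be extendible. Replacing its last block gives a string that extends into \<open>Qplus\<close>;
  there \<open>c\<close> still produces the whole new stack of kind 1, which is therefore an initial
  segment of a member of \<open>P\<close>.\<close>

lemma state_inv_next:
  assumes inv: "state_inv c g0 n0 i p w" and nxt: "next_state c i p w p' w'"
  shows "state_inv c g0 n0 (Suc i) p' w' \<and>
    stack 1 (lnth w') (Suc p') = stack 1 (lnth w) (Suc p) @ [letter (lnth w') p']"
proof -
  let ?v = "lnth w" and ?v' = "lnth w'"
  have pp': "p < p'" and agree: "\<And>j. j < 3 * Suc p \<Longrightarrow> ?v' j = ?v j"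
    and bin: "\<And>j. j < 3 * Suc p' \<Longrightarrow> ?v' j \<le> 1"
    and kd0: "\<And>j. p < j \<Longrightarrow> j < p' \<Longrightarrow> kind ?v' j = 0" and kd1: "kind ?v' p' = 1"
    and TL0: "\<And>j. j \<le> p' \<Longrightarrow> in_tree (stack 0 ?v' j)"
    and bounded_run: "bounded_run c ?v' (3 * p') i = Suc (letter ?v' p')"
    using nxt by (auto simp: next_state_def)
  have v: "good ?v (Suc p)" "n0 \<le> 3 * Suc p" "\<And>j. j < n0 \<Longrightarrow> ?v j = g0 j"
    "length (stack 1 ?v (Suc p)) = i"
    "\<And>j. j < i \<Longrightarrow> \<exists>L\<le>3 * Suc p. bounded_run c ?v L j = Suc (stack 1 ?v (Suc p) ! j)"
    using inv by (auto simp: state_inv_def simp del: stack.simps)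
  have stack_v: "stack k ?v' (Suc p) = stack k ?v (Suc p)" for k by (rule stack_cong) (rule agree)
  \<comment> \<open>Only blocks of kind 0 intervene, and they do not touch stacks of positive
    kind.\<close>
  have main: "good ?v' m \<and> (\<forall>k>0. stack k ?v' m = stack k ?v (Suc p))" if "Suc p \<le> m" "m \<le> p'" for m
    using that
  proof (induction m rule: dec_induct)
    case base
    have "good ?v' (Suc p) = good ?v (Suc p)" by (rule good_cong) (rule agree)
    with v(1) stack_v show ?case by blast
  next
    case (step m)
    then have IH: "good ?v' m" "\<And>k. 0 < k \<Longrightarrow> stack k ?v' m = stack k ?v (Suc p)" and m: "p < m" "m < p'"
      by auto
    have stack: "stack k ?v' (Suc m) = stack k ?v (Suc p)" if "0 < k" for k
      using that IH(2) [OF that] kd0 [OF m] by simp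
    have "extendible (stack 2 ?v (Suc p))" "extendible (stack 1 ?v (Suc p))" using v(1) by (auto simp: good_def)
    with stack [of 1] stack [of 2] IH(1) TL0 [of "Suc m"] bin m show ?case
      by (simp add: good_Suc stack del: stack.simps)
  qed
  have good': "good ?v' p'" and kb': "stack 1 ?v' p' = stack 1 ?v (Suc p)"
    using main [of p'] pp' by auto
  have n0: "n0 \<le> 3 * p'" using v(2) pp' by simp
  have v'g0: "?v' j = g0 j" if "j < n0" for j using agree [of j] v(2,3) that by simp
  have stack_Suc: "stack 1 ?v' (Suc p') = stack 1 ?v (Suc p) @ [letter ?v' p']"
    "stack 0 ?v' (Suc p') = []" "stack 2 ?v' (Suc p') = stack 2 ?v' p'"
  proof -
    have "stack k ?v' (Suc p') = (if k < 1 then [] else if 1 = k then stack k ?v' p' @ [letter ?v' p']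
        else stack k ?v' p')" for k
      using kd1 by simp
    from this [of 1] this [of 0] this [of 2] show "stack 1 ?v' (Suc p') = stack 1 ?v (Suc p) @ [letter ?v' p']"
      "stack 0 ?v' (Suc p') = []" "stack 2 ?v' (Suc p') = stack 2 ?v' p'"
      using kb' by (simp_all del: stack.simps)
  qed
  \<comment> \<open>The bound \<open>3 * p'\<close> says that even the new bit is computed without
    looking at the block that carries it.\<close>
  have ev': "\<exists>L\<le>3 * p'. bounded_run c ?v' L j = Suc ((stack 1 ?v (Suc p) @ [letter ?v' p']) ! j)" if "j < Suc i" for j
  proof (cases "j = i")
    case True
    with bounded_run v(4) show ?thesis by (metis le_refl nth_append_length)
  next
    case False
    with that have "j < i" by simp
    from v(5) [OF this] obtain L where L: "L \<le> 3 * Suc p" "bounded_run c ?v L j = Suc (stack 1 ?v (Suc p) ! j)" by blast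
    have "bounded_run c ?v' L j = bounded_run c ?v L j" by (rule bounded_run_cong) (use agree L(1) in auto)
    moreover have "(stack 1 ?v (Suc p) @ [letter ?v' p']) ! j = stack 1 ?v (Suc p) ! j"
      using \<open>j < i\<close> v(4) by (simp add: nth_append del: stack.simps)
    moreover have "L \<le> 3 * p'" using L(1) pp' by simp
    ultimately show ?thesis using L(2) by metis
  qed
  have "extendible (stack 1 ?v (Suc p) @ [letter ?v' p'])"
  proof -
    have "extendible (stack 1 ?v' p')" using good' by (simp add: good_def)
    then obtain b where b: "b \<le> 1" "extendible (stack 1 ?v' p' @ [b])" by (rule extendible_snoc)
    \<comment> \<open>The bit \<open>b\<close> is known to be extendible, unlike the letter of block
      \<open>p'\<close>; its block also empties the stack of kind 0.\<close>
    define h where "h = glue ?v' (3 * p') (block 1 b)"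
    have h: "good h (Suc p')" "stack 0 h (Suc p') = []"
      using good_glue_block [OF good' _ b] by (simp_all add: h_def del: stack.simps)
    obtain f0 where "f0 \<in> P" using ex_mem_P ..
    define h' where "h' = glue h (3 * Suc p') (embed f0)"
    have "h' \<in> Qplus" unfolding h'_def by (rule glue_embed_mem_Qplus) fact+
    moreover have h'v: "h' j = ?v' j" if "j < 3 * p'" for j
      using that by (simp add: h'_def h_def glue_def)
    ultimately obtain f where f: "f \<in> P" "\<And>n. run c h' n = Some (f n)"
      using c [of h'] v'g0 n0 by force
    have "(stack 1 ?v (Suc p) @ [letter ?v' p']) ! j = f j" if "j < Suc i" for j
    proof -
      from ev' [OF that] obtain L where
        L: "L \<le> 3 * p'" "bounded_run c ?v' L j = Suc ((stack 1 ?v (Suc p) @ [letter ?v' p']) ! j)" by blast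
      have "bounded_run c h' L j = bounded_run c ?v' L j" by (rule bounded_run_cong) (use h'v L(1) in auto)
      with L(2) have "run c h' j = Some ((stack 1 ?v (Suc p) @ [letter ?v' p']) ! j)"
        by (intro bounded_run_sound) simp
      with f(2) show ?thesis by simp
    qed
    then have "stack 1 ?v (Suc p) @ [letter ?v' p'] = prefix_of f (Suc i)"
      using v(4) by (intro nth_equalityI) (simp_all del: stack.simps)
    with f(1) show ?thesis by (simp add: extendible_prefix_of del: stack.simps)
  qed
  then have "good ?v' (Suc p')"
    using good' bin extendible_imp_in_tree [OF extendible_Nil] stack_Suc unfolding good_Suc
    by (auto simp: good_def simp del: stack.simps)
  moreover have "\<exists>L\<le>3 * Suc p'. bounded_run c ?v' L j = Suc ((stack 1 ?v (Suc p) @ [letter ?v' p']) ! j)" if "j < Suc i" for j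
  proof -
    have "3 * p' \<le> 3 * Suc p'" by simp
    with ev' [OF that] show ?thesis by (meson le_trans)
  qed
  ultimately have "state_inv c g0 n0 (Suc i) p' w'"
    unfolding state_inv_def stack_Suc using n0 v'g0 v(4) by (simp del: stack.simps)
  with stack_Suc show ?thesis by blast
qed

text \<open>Iterating the search from an initial state computes the growing stack of kind 1. Its
  limit is a computable member of \<open>P\<close>, contradicting specialness.\<close>

lemma no_computable_map:
  assumes g0: "g0 \<in> Qplus"
  shows False
proof -
  have "good g0 n0" using g0 by (simp add: Qplus_def)
  moreover then have "extendible (stack 2 g0 n0)" by (simp add: good_def)
  then obtain b where b: "b \<le> 1" "extendible (stack 2 g0 n0 @ [b])" by (rule extendible_snoc)
  \<comment> \<open>Keeping \<open>3 * n0\<close> entries preserves \<open>g0\<close> below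
    \<open>n0\<close>. The block of kind 2 empties the stacks of kinds 0 and 1, as the invariant for
    \<open>i = 0\<close> demands.\<close>
  define h where "h = glue g0 (3 * n0) (block 2 b)"
  have h: "good h (Suc n0)" "\<And>i. i < 2 \<Longrightarrow> stack i h (Suc n0) = []"
    using good_glue_block [OF \<open>good g0 n0\<close> _ b] by (simp_all add: h_def del: stack.simps)
  obtain w0 where w0: "\<And>j. j < 3 * Suc n0 \<Longrightarrow> lnth w0 j = h j" using ex_lnth by blast
  have "good (lnth w0) (Suc n0) = good h (Suc n0)" by (rule good_cong) (rule w0)
  moreover have "stack k (lnth w0) (Suc n0) = stack k h (Suc n0)" for k by (rule stack_cong) (rule w0)
  moreover have "lnth w0 j = g0 j" if "j < n0" for j
    using w0 [of j] that by (simp add: h_def glue_def)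
  ultimately have inv0: "state_inv c g0 n0 0 n0 w0"
    using h by (simp add: state_inv_def del: stack.simps)

  obtain d where d: "\<And>g p w i. \<exists>p' w'. next_state c i p w p' w' \<Longrightarrow>
    \<exists>p' w'. run d g (prod_encode (prod_encode (p, w), i)) = Some (prod_encode (p', w')) \<and>
      next_state c i p w p' w'"
    using next_state_code by blast
  \<comment> \<open>The step receives parameter, counter and state and hands state and counter to
    \<open>d\<close>; the parameter is a dummy 0.\<close>
  define D where "D = Comp (Prec (numeral_code (prod_encode (n0, w0)))
      (Comp d (Pair (Comp Snd Snd) (Comp Fst Snd)))) (Pair Zero (Pair Fst Snd))"
  let ?run = "run D (\<lambda>_. 0)"
  have run_0: "?run 0 = Some (prod_encode (n0, w0))"
    by (simp add: D_def)
  have run_Suc: "?run (Suc i) = run d (\<lambda>_. 0) (prod_encode (s, i))" if "?run i = Some s" for i s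
    using that by (simp add: D_def)
  have states: "\<exists>p w. ?run i = Some (prod_encode (p, w)) \<and> state_inv c g0 n0 i p w" for i
  proof (induction i)
    case 0
    with run_0 inv0 show ?case by blast
  next
    case (Suc i)
    then obtain p w where pw: "?run i = Some (prod_encode (p, w))" "state_inv c g0 n0 i p w" by blast
    from d [OF ex_next_state [OF pw(2)]] obtain p' w' where
      "?run (Suc i) = Some (prod_encode (p', w'))" "next_state c i p w p' w'"
      using run_Suc [OF pw(1)] by metis
    with state_inv_next [OF pw(2)] show ?case by blast
  qed
  then obtain p w where run: "\<And>i. ?run i = Some (prod_encode (p i, w i))"
    and inv: "\<And>i. state_inv c g0 n0 i (p i) (w i)" by metis
  \<comment> \<open>Evaluation is single-valued, so the successor found by \<open>d\<close> is the
    chosen state.\<close>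
  have nxt: "next_state c i (p i) (w i) (p (Suc i)) (w (Suc i))" for i
    using d [OF ex_next_state [OF inv], of "\<lambda>_. 0" i] run_Suc [OF run, of i] run [of "Suc i"] by auto
  define f where "f i = letter (lnth (w (Suc i))) (p (Suc i))" for i
  have "stack 1 (lnth (w i)) (Suc (p i)) = prefix_of f i" for i
  proof (induction i)
    case 0
    then show ?case using inv [of 0] by (simp add: state_inv_def prefix_of_def del: stack.simps)
  next
    case (Suc i)
    then show ?case using state_inv_next [OF inv nxt, of i] by (simp add: prefix_of_Suc f_def del: stack.simps)
  qed
  moreover have "extendible (stack 1 (lnth (w i)) (Suc (p i)))" for i
    using inv [of i] by (simp add: state_inv_def good_def del: stack.simps)
  ultimately have "T f i" for i using extendible_imp_in_tree in_tree_prefix_of by metis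
  then have "f \<in> P" by (simp add: mem_P_iff)
  moreover have "computable f"
  proof -
    have "recursive (\<lambda>g x. letter (lnth (proj2 x)) (proj1 x))"
      unfolding letter_def by (intro recursive_intros recursive_const recursive_lnth)
    then obtain a where "\<And>g x. run a g x = Some (letter (lnth (proj2 x)) (proj1 x))"
      unfolding recursive_def by blast
    then have "run (Comp a (Comp D Succ)) (\<lambda>_. 0) i = Some (f i)" for i
      using run [of "Suc i"] by (simp add: f_def)
    then show ?thesis unfolding computable_def by blast
  qed
  ultimately show False using special_P by (auto simp: special_def)
qed

end

text \<open>Where the guess is constant, one program maps all members of \<open>Qplus\<close> above
  a string into \<open>P\<close>, which the diagonal construction excludes.\<close>

lemma not_le_one_omega_P_Q: "\<not> le_one_omega P Q"
proof
  assume "le_one_omega P Q"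
  then obtain \<Gamma> \<psi> where \<psi>: "\<And>g. g \<in> dom \<Gamma> \<Longrightarrow> identifies \<psi> \<Gamma> g"
    and \<Gamma>: "Q \<subseteq> dom \<Gamma>" "\<And>g. g \<in> Q \<Longrightarrow> the (\<Gamma> g) \<in> P"
    unfolding le_one_omega_def reducible_by_def one_omega_computable_def by blast
  have id: "identifies \<psi> \<Gamma> g" "\<exists>f\<in>P. \<Gamma> g = Some f" if "g \<in> Qplus" for g
  proof -
    have g: "g \<in> Q" using that Qplus_subset_Q by blast
    with \<Gamma>(1) have "g \<in> dom \<Gamma>" by blast
    with \<psi> \<Gamma>(2) [OF g] show "identifies \<psi> \<Gamma> g" "\<exists>f\<in>P. \<Gamma> g = Some f" by force+
  qed
  have "convergent (\<lambda>n. \<psi> (prefix_of g n))" if "g \<in> Qplus" for g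
    using id(1) [OF that] by (simp add: identifies_def)
  from ex_constant_learner [OF this] obtain g0 n0 where g0: "g0 \<in> Qplus"
    "\<And>g n. g \<in> Qplus \<Longrightarrow> (\<And>i. i < n0 \<Longrightarrow> g i = g0 i) \<Longrightarrow> n0 \<le> n \<Longrightarrow>
       \<psi> (prefix_of g n) = \<psi> (prefix_of g0 n0)"
    by blast
  let ?e = "\<psi> (prefix_of g0 n0)"
  have "\<exists>f\<in>P. \<forall>n. run (program ?e) g n = Some (f n)"
    if g: "g \<in> Qplus" "\<And>i. i < n0 \<Longrightarrow> g i = g0 i" for g
  proof -
    have "\<forall>\<^sub>F n in sequentially. \<psi> (prefix_of g n) = ?e"
      using g0(2) [OF g] by (auto simp: eventually_sequentially)
    then have "lim (\<lambda>n. \<psi> (prefix_of g n)) = ?e" by (intro limI tendsto_eventually)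
    with id [OF g(1)] obtain f where f: "f \<in> P" "Phi ?e g = Some f" by (auto simp: identifies_def)
    then have "run (program ?e) g n = Some (f n)" for n by (auto simp: Phi_def split: if_splits)
    with f(1) show ?thesis by blast
  qed
  from no_computable_map [OF this g0(1)] show False by blast
qed

end

theorem corollary56:
  fixes P :: "(nat \<Rightarrow> nat) set"
  assumes "P \<subseteq> cantor" and "Pi01 P" and "special P"
  shows "\<exists>Q. Q \<subseteq> cantor \<and> Pi01 Q \<and> less_one_omega Q P \<and> equiv_fin_omega P Q"
proof -
  from \<open>Pi01 P\<close> obtain R c where "P = {g. \<forall>n. R n g}" "\<And>g n. run c g n = Some (if R n g then 1 else 0)"
    unfolding Pi01_def computable_rel_def by blast
  then have mem: "f \<in> P \<longleftrightarrow> (\<forall>L. tree c f L)" for f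
    using assms(1) by (intro mem_Pi01_iff_tree)
  interpret special_class P "tree c"
  proof
    show "tree c g L = tree c h L" if "\<And>i. i < L \<Longrightarrow> g i = h i" for g h L
      using that by (rule tree_cong)
    show "decidable (tree c)" by (rule decidable_tree)
    show "g i \<le> 1" if "tree c g L" "i < L" for g L i using that by (simp add: tree_def)
  qed (fact mem assms(3))+
  show ?thesis
    using Q_subset_cantor Pi01_Q le_one_omega_Q_P not_le_one_omega_P_Q le_fin_omega_P_Q
      le_one_omega_imp_le_fin_omega
    unfolding less_one_omega_def equiv_fin_omega_def by blast
qed

end
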